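(* Let $X$ be a complex Banach space with the Gaussian Average Property (GAP). There is a constant $C\ge1$ such that for all $m,n\in\mathbb{N}$ and every choice of vectors $\{x_\alpha\}_{\alpha\in\mathbb{N}_0^n,|\alpha|\le m}\subseteq X$, \[ \Big(\mathbb{E}\Big\|\sum_{|\alpha|\le m}\varepsilon_{i_\alpha}x_\alpha\Big\|^2\Big)^{1/2}\le C\,\mathbb{E}\Big\|\sum_{|\alpha|\le m}\sqrt2^{|\alpha|}x_\alpha w^\alpha\Big\|. \]
   Context: For $\alpha\in\mathbb{N}_0^n$, $|\alpha|=\alpha_1+\dots+\alpha_n$ and $w^\alpha=w_1^{\alpha_1}\cdots w_n^{\alpha_n}$, where $w=(w_1,\dots,w_n)$ has independent coordinates uniformly distributed on the unit circle $\mathbb{T}$. $\{\varepsilon_{i_\alpha}\}_\alpha$ is a family of independent Rademacher variables, one for each multi-index $\alpha$ with $|\alpha|\le m$. For an operator $S:Y\to Z$, its $1$-summing norm $\pi_1(S)$ is the least $C$ with $\sum_i\|Sy_i\|\le C\sup_{y^*\in B_{Y^*}}\sum_i|y^*(y_i)|$ for all finite families $y_i\in Y$. $X$ has GAP if there is $C\ge1$ such that for all $x_1,\dots,x_n\in X$, with $T:\ell_2^n\to X$, $T(e_i)=x_i$, one has $(\mathbb{E}\|\sum_i x_i\gamma_i\|^2)^{1/2}\le C\pi_1(T^* )$, where $\gamma_i$ are independent standard complex gaussian variables. *)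

theory Defs
  imports "HOL-Probability.Probability"
begin

definition complex_banach :: "(complex \<Rightarrow> 'a::banach \<Rightarrow> 'a) \<Rightarrow> bool" where
  "complex_banach cmul \<longleftrightarrow>
     (\<forall>a b x. cmul (a + b) x = cmul a x + cmul b x) \<and>
     (\<forall>a x y. cmul a (x + y) = cmul a x + cmul a y) \<and>
     (\<forall>a b x. cmul (a * b) x = cmul a (cmul b x)) \<and>
     (\<forall>r x. cmul (complex_of_real r) x = r *\<^sub>R x) \<and>
     (\<forall>a x. norm (cmul a x) = cmod a * norm x)"

definition cdual :: "(complex \<Rightarrow> 'a::banach \<Rightarrow> 'a) \<Rightarrow> ('a \<Rightarrow> complex) set" where
  "cdual cmul = {f. (\<forall>x y. f (x + y) = f x + f y) \<and> (\<forall>a x. f (cmul a x) = a * f x) \<and>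
                    (\<exists>K. \<forall>x. cmod (f x) \<le> K * norm x)}"

definition dnorm :: "('a::banach \<Rightarrow> complex) \<Rightarrow> real" where
  "dnorm f = (SUP x\<in>{x. norm x \<le> 1}. cmod (f x))"

definition bidual_ball :: "(complex \<Rightarrow> 'a::banach \<Rightarrow> 'a) \<Rightarrow> (('a \<Rightarrow> complex) \<Rightarrow> complex) set" where
  "bidual_ball cmul = {\<phi>. (\<forall>f\<in>cdual cmul. \<forall>g\<in>cdual cmul. \<phi> (\<lambda>x. f x + g x) = \<phi> f + \<phi> g) \<and>
                          (\<forall>a. \<forall>f\<in>cdual cmul. \<phi> (\<lambda>x. a * f x) = a * \<phi> f) \<and>
                          (\<forall>f\<in>cdual cmul. cmod (\<phi> f) \<le> dnorm f)}"

text \<open>1-summing norm of T*: X* \<rightarrow> (l_2^n)*, where T: l_2^n \<rightarrow> X, T e_i = x i (i < n).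
  For y \<in> X*, the norm of T* y = y \<circ> T in (l_2^n)* is sqrt (\<Sum>i<n. |y (x i)|^2).\<close>
definition pi1_adj :: "(complex \<Rightarrow> 'a::banach \<Rightarrow> 'a) \<Rightarrow> (nat \<Rightarrow> 'a) \<Rightarrow> nat \<Rightarrow> real" where
  "pi1_adj cmul x n = Inf {C. C \<ge> 0 \<and>
      (\<forall>(k::nat) (ys::nat \<Rightarrow> 'a \<Rightarrow> complex). (\<forall>j<k. ys j \<in> cdual cmul) \<longrightarrow>
         (\<Sum>j<k. sqrt (\<Sum>i<n. (cmod (ys j (x i)))\<^sup>2))
           \<le> C * (SUP \<phi>\<in>bidual_ball cmul. \<Sum>j<k. cmod (\<phi> (ys j))))}"

definition cgauss :: "complex measure" where
  "cgauss = distr (density lborel (normal_density 0 (1 / sqrt 2)) \<Otimes>\<^sub>M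
                   density lborel (normal_density 0 (1 / sqrt 2))) borel (\<lambda>(a, b). Complex a b)"

definition steinhaus :: "complex measure" where
  "steinhaus = distr (uniform_measure lborel {0..2 * pi}) borel cis"

definition rademacher :: "real measure" where
  "rademacher = measure_pmf (pmf_of_set {-1, 1})"

definition GAP :: "(complex \<Rightarrow> 'a::banach \<Rightarrow> 'a) \<Rightarrow> bool" where
  "GAP cmul \<longleftrightarrow> (\<exists>C\<ge>1. \<forall>(n::nat) (x::nat \<Rightarrow> 'a).
     sqrt (\<integral>g. (norm (\<Sum>i<n. cmul (g i) (x i)))\<^sup>2 \<partial>(PiM {..<n} (\<lambda>_. cgauss)))
       \<le> C * pi1_adj cmul x n)"

definition multi_idx :: "nat \<Rightarrow> nat \<Rightarrow> (nat \<Rightarrow> nat) set" where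
  "multi_idx n m = {\<alpha>. (\<forall>i\<ge>n. \<alpha> i = 0) \<and> (\<Sum>i<n. \<alpha> i) \<le> m}"

definition mabs :: "nat \<Rightarrow> (nat \<Rightarrow> nat) \<Rightarrow> nat" where
  "mabs n \<alpha> = (\<Sum>i<n. \<alpha> i)"

definition mpow :: "nat \<Rightarrow> (nat \<Rightarrow> complex) \<Rightarrow> (nat \<Rightarrow> nat) \<Rightarrow> complex" where
  "mpow n w \<alpha> = (\<Prod>i<n. w i ^ \<alpha> i)"

end

theory Submission
  imports Defs "HOL-Computational_Algebra.Fundamental_Theorem_Algebra"
begin

text \<open>By Jensen's inequality, applied one coordinate at a time, Rademacher averages are dominated by
  Gaussian averages, which GAP bounds by \<open>\<pi>\<^sub>1(T\<^sup>*)\<close>. It remains to compare \<open>\<pi>\<^sub>1(T\<^sup>*)\<close> with the mean of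
  \<open>\<parallel>F(w)\<parallel>\<close>, where \<open>F(w)\<close> is the weighted polynomial on the torus. For a functional \<open>y\<close>, the scalar
  polynomial \<open>y(F(w))\<close> satisfies Weissler's inequality
  \<open>(\<Sum> |y(x\<^sub>\<alpha>)|\<^sup>2)\<^sup>1\<^sup>/\<^sup>2 \<le> E |y(F(w))|\<close> with constant \<open>1\<close>; summing over finitely many functionals, the integrand is at
  most \<open>\<parallel>F(w)\<parallel>\<close> times the weak norm, because normalized point evaluations lie in the bidual ball.
  Weissler's inequality tensorizes by Minkowski's inequality. In one variable a polynomial is written
  as a product \<open>b c\<close> of power series with \<open>|b|\<^sup>2 = |c|\<^sup>2 = |p|\<close> on the circle, and one applies
  Cauchy--Schwarz to the coefficients of the product and Bessel's inequality to the factors.\<close>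

section \<open>Square-root factorization of polynomials on the unit circle\<close>

text \<open>Absolute summability makes evaluation, and products of values, legitimate on the closed
  disc. A condition on the open disc alone would not suffice: the square root of
  \<open>1 + u * z\<close> with \<open>norm u = 1\<close> has a branch point on the circle.\<close>

definition abs_summable_fps :: "complex fps \<Rightarrow> bool" where
  "abs_summable_fps f \<longleftrightarrow> summable (\<lambda>n. norm (fps_nth f n))"

lemma abs_summable_fps_terms:
  assumes "abs_summable_fps f" "norm z \<le> 1"
  shows "summable (\<lambda>n. norm (fps_nth f n * z ^ n))"
proof (rule summable_comparison_test')
  show "summable (\<lambda>n. norm (fps_nth f n))"
    using assms(1) by (simp add: abs_summable_fps_def)
  show "norm (norm (fps_nth f n * z ^ n)) \<le> norm (fps_nth f n)" if "n \<ge> 0" for n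
    using assms(2) by (simp add: norm_mult norm_power mult_left_le power_le_one)
qed

lemma abs_summable_fps_mult:
  assumes "abs_summable_fps f" "abs_summable_fps g"
  shows "abs_summable_fps (f * g)"
  unfolding abs_summable_fps_def
proof (rule summable_comparison_test')
  show "summable (\<lambda>k. \<Sum>i\<le>k. norm (fps_nth f i) * norm (fps_nth g (k - i)))"
    using assms unfolding abs_summable_fps_def by (intro summable_Cauchy_product) simp_all
  show "norm (norm (fps_nth (f * g) k))
      \<le> (\<Sum>i\<le>k. norm (fps_nth f i) * norm (fps_nth g (k - i)))" if "k \<ge> 0" for k
    unfolding fps_mult_nth atMost_atLeast0 real_norm_def abs_norm_cancel
    by (rule order_trans[OF norm_sum]) (simp add: norm_mult)
qed

lemma eval_fps_mult_unit_disc: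
  assumes "abs_summable_fps f" "abs_summable_fps g" "norm z \<le> 1"
  shows "eval_fps (f * g) z = eval_fps f z * eval_fps g z"
proof -
  have "eval_fps f z * eval_fps g z =
      (\<Sum>k. \<Sum>i\<le>k. (fps_nth f i * z ^ i) * (fps_nth g (k - i) * z ^ (k - i)))"
    unfolding eval_fps_def
    by (intro Cauchy_product abs_summable_fps_terms assms)
  also have "(\<lambda>k. \<Sum>i\<le>k. (fps_nth f i * z ^ i) * (fps_nth g (k - i) * z ^ (k - i)))
      = (\<lambda>k. fps_nth (f * g) k * z ^ k)"
    unfolding fps_mult_nth sum_distrib_right atMost_atLeast0
    by (intro ext sum.cong refl) (simp add: power_add [symmetric] algebra_simps)
  finally show ?thesis
    by (simp add: eval_fps_def)
qed

lemma abs_summable_fps_of_poly: "abs_summable_fps (fps_of_poly p)"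
  unfolding abs_summable_fps_def
  by (rule summable_finite[of "{..degree p}"]) (auto simp: coeff_eq_0)

text \<open>The binomial series of \<open>1 + u * z\<close> raised to the power \<open>c\<close>.
  Working with formal series turns exponent laws into coefficient identities and avoids choosing a
  branch.\<close>

definition scaled_binomial_fps :: "complex \<Rightarrow> complex \<Rightarrow> complex fps" where
  "scaled_binomial_fps c u = Abs_fps (\<lambda>n. (c gchoose n) * u ^ n)"

text \<open>Vandermonde's convolution is the law of exponents, read off coefficient by
  coefficient.\<close>

lemma scaled_binomial_fps_mult:
  "scaled_binomial_fps c u * scaled_binomial_fps d u = scaled_binomial_fps (c + d) u"
proof (rule fps_ext)
  fix n
  have "fps_nth (scaled_binomial_fps c u * scaled_binomial_fps d u) n
      = (\<Sum>i=0..n. ((c gchoose i) * (d gchoose (n - i))) * u ^ n)"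
    unfolding fps_mult_nth scaled_binomial_fps_def fps_nth_Abs_fps
    by (intro sum.cong refl) (simp add: power_add [symmetric] algebra_simps)
  also have "\<dots> = fps_nth (scaled_binomial_fps (c + d) u) n"
    by (simp add: sum_distrib_right [symmetric] gbinomial_Vandermonde scaled_binomial_fps_def)
  finally show "fps_nth (scaled_binomial_fps c u * scaled_binomial_fps d u) n
      = fps_nth (scaled_binomial_fps (c + d) u) n" .
qed

lemma scaled_binomial_fps_1: "scaled_binomial_fps 1 u = fps_of_poly [:1, u:]"
proof (rule fps_ext)
  fix n
  show "fps_nth (scaled_binomial_fps 1 u) n = fps_nth (fps_of_poly [:1, u:]) n"
    unfolding scaled_binomial_fps_def fps_nth_Abs_fps
    using binomial_gbinomial[of 1 n, where ?'a = complex]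
    by (cases n; cases "n - 1") (auto simp: coeff_pCons split: nat.split)
qed

lemma scaled_binomial_fps_0: "scaled_binomial_fps 0 u = 1"
  by (rule fps_ext) (auto simp: scaled_binomial_fps_def gbinomial_0_left)

text \<open>With alternating signs all coefficients after the first are nonpositive, while the partial sums
  \<open>(- 1) ^ n * (- 1 / 2 gchoose n)\<close> stay nonnegative, so the absolute values sum to at most \<open>2\<close>.\<close>
lemma summable_half_gchoose: "summable (\<lambda>n. \<bar>(1 / 2 :: real) gchoose n\<bar>)"
proof -
  define s :: "nat \<Rightarrow> real" where "s n = (1 / 2 gchoose n) * (- 1) ^ n" for n
  have s_Suc: "s (Suc n) = s n * (real n - 1 / 2) / (real n + 1)" for n
    unfolding s_def using gbinomial_absorption'[of "Suc n" "1 / 2 :: real"]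
    by (simp add: gbinomial_Suc_rec field_simps) 
  have neg: "s (Suc n) \<le> 0" for n
  proof (induction n)
    case (Suc n)
    then show ?case
      by (subst s_Suc) (intro divide_nonpos_nonneg mult_nonpos_nonneg, auto)
  qed (simp add: s_def)
  have sum_pos: "(\<Sum>k\<le>n. s k) \<ge> 0" for n
  proof -
    have t_Suc: "(- 1) ^ Suc m * (- 1 / 2 gchoose Suc m)
        = (- 1) ^ m * (- 1 / 2 gchoose m) * (real m + 1 / 2) / (real m + 1)" for m
      by (simp add: gbinomial_Suc_rec field_simps)
    have "(- 1) ^ m * (- 1 / 2 gchoose m) \<ge> (0 :: real)" for m
    proof (induction m)
      case (Suc m)
      then show ?case unfolding t_Suc by simp
    qed simp
    then show ?thesis
      unfolding s_def gbinomial_sum_lower_neg by simp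
  qed
  have "(\<Sum>k<n. \<bar>s (Suc k)\<bar>) \<le> 1" for n
  proof -
    have "(\<Sum>k<n. \<bar>s (Suc k)\<bar>) = - (\<Sum>k<n. s (Suc k))"
      using neg by (simp add: sum_negf [symmetric] abs_of_nonpos)
    also have "\<dots> = s 0 - (\<Sum>k\<le>n. s k)"
      by (simp add: sum.atMost_shift)
    also have "\<dots> \<le> 1"
      using sum_pos[of n] by (simp add: s_def)
    finally show ?thesis .
  qed
  then have "summable (\<lambda>n. \<bar>s (Suc n)\<bar>)"
    by (intro bounded_imp_summable[of _ 1]) (auto simp only: lessThan_Suc_atMost [symmetric] abs_ge_zero)
  then show ?thesis
    by (subst summable_Suc_iff [symmetric]) (simp add: s_def abs_mult)
qed

text \<open>Consecutive coefficients have a ratio of modulus \<open>(n + 1 / 2) / (n + 1)\<close>.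
  The inverse square root is only used with \<open>norm u < 1\<close>, where bounded coefficients
  leave a geometric majorant.\<close>

lemma abs_minus_half_gchoose_le: "\<bar>(- 1 / 2 :: real) gchoose n\<bar> \<le> 1"
proof (induction n)
  case (Suc n)
  have "\<bar>(- 1 / 2 :: real) gchoose Suc n\<bar>
      = \<bar>(- 1 / 2 :: real) gchoose n\<bar> * ((real n + 1 / 2) / (real n + 1))"
  proof -
    have "(- 1 / 2 :: real) gchoose Suc n
        = - (((- 1 / 2) gchoose n) * ((real n + 1 / 2) / (real n + 1)))"
      by (simp add: gbinomial_Suc_rec field_simps)
    then show ?thesis by (simp only: abs_minus_cancel abs_mult) simp
  qed
  also have "\<dots> \<le> 1 * 1"
    by (intro mult_mono Suc) auto
  finally show ?case by simp
qed simp

lemma cmod_gchoose_of_real: "norm (complex_of_real a gchoose n) = \<bar>a gchoose n\<bar>"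
proof -
  have "complex_of_real a gchoose n = complex_of_real (a gchoose n)"
    by (simp add: gbinomial_prod_rev)
  then show ?thesis by simp
qed

lemma abs_summable_sqrt_fps:
  assumes "norm u \<le> 1"
  shows "abs_summable_fps (scaled_binomial_fps (1 / 2) u)"
  unfolding abs_summable_fps_def
proof (rule summable_comparison_test')
  show "norm (norm (fps_nth (scaled_binomial_fps (1 / 2) u) n)) \<le> \<bar>(1 / 2 :: real) gchoose n\<bar>"
    if "n \<ge> 0" for n
    using assms cmod_gchoose_of_real[of "1 / 2" n]
    by (simp add: scaled_binomial_fps_def norm_mult norm_power mult_left_le power_le_one)
qed (rule summable_half_gchoose)

lemma abs_summable_inverse_sqrt_fps:
  assumes "norm u < 1"
  shows "abs_summable_fps (scaled_binomial_fps (- (1 / 2)) u)"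
  unfolding abs_summable_fps_def
proof (rule summable_comparison_test')
  show "norm (norm (fps_nth (scaled_binomial_fps (- (1 / 2)) u) n)) \<le> norm u ^ n"
    if "n \<ge> 0" for n
    using cmod_gchoose_of_real[of "- (1 / 2)" n] abs_minus_half_gchoose_le[of n]
    by (simp add: scaled_binomial_fps_def norm_mult norm_power mult_left_le_one_le)
qed (use assms in simp)

lemma eval_sqrt_fps_square:
  assumes "norm u \<le> 1" "norm z \<le> 1"
  shows "(eval_fps (scaled_binomial_fps (1 / 2) u) z)\<^sup>2 = 1 + u * z"
proof -
  have "(eval_fps (scaled_binomial_fps (1 / 2) u) z)\<^sup>2
      = eval_fps (scaled_binomial_fps (1 / 2) u * scaled_binomial_fps (1 / 2) u) z"
    unfolding power2_eq_square using assms
    by (intro eval_fps_mult_unit_disc [symmetric] abs_summable_sqrt_fps)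
  also have "\<dots> = 1 + u * z"
    by (simp add: scaled_binomial_fps_mult scaled_binomial_fps_1 algebra_simps)
  finally show ?thesis .
qed

lemma eval_inverse_sqrt_fps_mult:
  assumes "norm u < 1" "norm z \<le> 1"
  shows "eval_fps (scaled_binomial_fps (- (1 / 2)) u) z * eval_fps (scaled_binomial_fps (1 / 2) u) z = 1"
proof -
  have "eval_fps (scaled_binomial_fps (- (1 / 2)) u) z * eval_fps (scaled_binomial_fps (1 / 2) u) z
      = eval_fps (scaled_binomial_fps (- (1 / 2)) u * scaled_binomial_fps (1 / 2) u) z"
    using assms
    by (intro eval_fps_mult_unit_disc [symmetric] abs_summable_sqrt_fps
        abs_summable_inverse_sqrt_fps) auto
  also have "\<dots> = 1"
    by (simp add: scaled_binomial_fps_mult scaled_binomial_fps_0)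
  finally show ?thesis .
qed

text \<open>Polynomial form of the factorization of a Hardy space function in \<open>H1\<close> into
  two \<open>H2\<close> factors of equal modulus on the circle. The product is an identity of formal
  series because the coefficients of \<open>p\<close> are what has to be estimated.\<close>

definition balanced_factors :: "complex poly \<Rightarrow> complex fps \<Rightarrow> complex fps \<Rightarrow> bool" where
  "balanced_factors p b c \<longleftrightarrow> abs_summable_fps b \<and> abs_summable_fps c \<and> b * c = fps_of_poly p \<and>
     (\<forall>z. norm z = 1 \<longrightarrow> (norm (eval_fps b z))\<^sup>2 = norm (poly p z) \<and>
                         (norm (eval_fps c z))\<^sup>2 = norm (poly p z))"

text \<open>Multiplicativity allows a factorization to be assembled root by root.\<close>

lemma balanced_factors_mult:
  assumes "balanced_factors p b c" "balanced_factors q b' c'"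
  shows "balanced_factors (p * q) (b * b') (c * c')"
  using assms unfolding balanced_factors_def
  by (auto simp: abs_summable_fps_mult eval_fps_mult_unit_disc norm_mult power_mult_distrib
      fps_of_poly_mult algebra_simps)

lemma balanced_factors_const:
  "balanced_factors [:a:] (fps_const (csqrt a)) (fps_const (csqrt a))"
proof -
  have "abs_summable_fps (fps_const d)" for d
    using abs_summable_fps_of_poly[of "[:d:]"] by (simp add: fps_of_poly_const)
  then show ?thesis
    unfolding balanced_factors_def
    by (auto simp: fps_const_mult power2_eq_square[symmetric] norm_power [symmetric]
        simp del: fps_const_mult)
qed

text \<open>With \<open>norm u \<le> 1\<close> there is no zero in the open disc, so a square root
  exists as a power series and serves as both factors.\<close>

lemma balanced_factors_outer:
  assumes "norm u \<le> 1"
  shows "balanced_factors [:1, u:] (scaled_binomial_fps (1 / 2) u) (scaled_binomial_fps (1 / 2) u)"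
  unfolding balanced_factors_def
  using assms eval_sqrt_fps_square[OF assms]
  by (auto simp: abs_summable_sqrt_fps scaled_binomial_fps_mult scaled_binomial_fps_1
      norm_power [symmetric] algebra_simps)

text \<open>A root \<open>r\<close> inside the disc is reflected: \<open>norm (z - r) = norm (1 - cnj r * z)\<close> on the circle, and
  \<open>1 - cnj r * z\<close> has a square root in the closed disc.\<close>
lemma balanced_factors_inner:
  assumes "norm r < 1"
  shows "balanced_factors [:- r, 1:]
    (fps_of_poly [:- r, 1:] * scaled_binomial_fps (- (1 / 2)) (- cnj r))
    (scaled_binomial_fps (1 / 2) (- cnj r))"
proof -
  let ?u = "- cnj r"
  have u: "norm ?u < 1" "norm ?u \<le> 1"
    using assms by auto
  have refl: "norm (1 + ?u * z) = norm (z - r)" if "norm z = 1" for z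
  proof -
    \<comment> \<open>On the circle \<open>z * cnj z = 1\<close>.\<close>
    have "1 + ?u * z = z * cnj (z - r)"
      using that complex_norm_square[of z] by (simp add: algebra_simps)
    then show ?thesis
      using that by (simp add: norm_mult del: complex_cnj_diff)
  qed
  have sq: "(norm (eval_fps (scaled_binomial_fps (1 / 2) ?u) z))\<^sup>2 = norm (z - r)"
    if "norm z = 1" for z
    using eval_sqrt_fps_square[of ?u z] refl[OF that] u that by (simp add: norm_power [symmetric])
  have inv: "(norm (eval_fps (scaled_binomial_fps (- (1 / 2)) ?u) z))\<^sup>2 * norm (z - r) = 1"
    if "norm z = 1" for z
    using arg_cong[OF eval_inverse_sqrt_fps_mult[of ?u z], of norm] u that
    by (simp add: sq [symmetric] norm_mult power_mult_distrib [symmetric])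
  show ?thesis
    unfolding balanced_factors_def
  proof (intro conjI allI impI)
    show "fps_of_poly [:- r, 1:] * scaled_binomial_fps (- (1 / 2)) ?u * scaled_binomial_fps (1 / 2) ?u
        = fps_of_poly [:- r, 1:]"
      by (simp only: mult.assoc scaled_binomial_fps_mult) (simp add: scaled_binomial_fps_0)
    show "(norm (eval_fps (fps_of_poly [:- r, 1:] * scaled_binomial_fps (- (1 / 2)) ?u) z))\<^sup>2
        = norm (poly [:- r, 1:] z)" if "norm z = 1" for z
    proof -
      \<comment> \<open>The first factor carries the zero \<open>r\<close>: its squared modulus is
        \<open>norm (z - r)\<close> squared, divided by \<open>norm (z - r)\<close> through the
        inverse square root.\<close>
      have "(norm (eval_fps (fps_of_poly [:- r, 1:] * scaled_binomial_fps (- (1 / 2)) ?u) z))\<^sup>2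
          = (norm (z - r))\<^sup>2 * (norm (eval_fps (scaled_binomial_fps (- (1 / 2)) ?u) z))\<^sup>2"
        using u that
        by (subst eval_fps_mult_unit_disc)
          (auto simp: abs_summable_fps_of_poly abs_summable_inverse_sqrt_fps eval_fps_of_poly
            norm_mult power_mult_distrib)
      also have "\<dots> = norm (z - r)"
        using inv[OF that] by (simp add: power2_eq_square mult_ac)
      finally show ?thesis by simp
    qed
  qed (use u sq in \<open>auto intro!: abs_summable_fps_mult abs_summable_fps_of_poly
         abs_summable_inverse_sqrt_fps abs_summable_sqrt_fps\<close>)
qed

lemma balanced_factors_linear: "\<exists>b c. balanced_factors [:- r, 1:] b c"
proof (cases "norm r < 1")
  case True
  then show ?thesis using balanced_factors_inner by blast
next
  case False
  then have "norm (- 1 / r) \<le> 1" "r \<noteq> 0"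
    by (auto simp: norm_divide divide_simps)
  \<comment> \<open>A root on or outside the circle is moved into the constant \<open>- r\<close>,
    leaving a linear factor without zeros in the open disc.\<close>
  moreover have "[:- r, 1:] = [:- r:] * [:1, - 1 / r:]"
    using \<open>r \<noteq> 0\<close> by simp
  ultimately show ?thesis
    using balanced_factors_mult[OF balanced_factors_const balanced_factors_outer] by metis
qed

text \<open>Induction on the degree: the fundamental theorem of algebra supplies a root, and its
  linear factor is split off.\<close>

lemma balanced_factors_exist: "\<exists>b c. balanced_factors p b c"
proof (induction "degree p" arbitrary: p rule: less_induct)
  case less
  show ?case
  proof (cases "degree p = 0")
    case True
    then show ?thesis
      using balanced_factors_const by (metis degree_eq_zeroE)
  next
    case False
    then obtain r where "poly p r = 0"
      using Fundamental_Theorem_Algebra.fundamental_theorem_of_algebra[of p] by (auto simp: constant_degree)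
    then obtain q where q: "p = [:- r, 1:] * q"
      by (auto simp: poly_eq_0_iff_dvd elim: dvdE)
    then have "q \<noteq> 0"
      using False by auto
    then have "degree q < degree p"
      unfolding q by (subst degree_mult_eq) auto
    from less[OF this] balanced_factors_linear[of r] show ?thesis
      unfolding q using balanced_factors_mult by blast
  qed
qed

section \<open>Hypercontractivity in one variable\<close>

lemma cis_borel_measurable:
  "cis \<in> borel_measurable (uniform_measure lborel A)"
proof -
  have "cis \<in> borel_measurable borel"
    by (intro borel_measurable_continuous_onI continuous_intros)
  then show ?thesis
    by (subst measurable_cong_sets[of _ borel _ borel]) auto
qed

lemma steinhaus_props:
  shows prob_space_steinhaus: "prob_space steinhaus"
    and sets_steinhaus [measurable_cong]: "sets steinhaus = sets borel"
    and AE_steinhaus: "AE w in steinhaus. norm w = 1"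
proof -
  interpret prob_space "uniform_measure lborel {0..2 * pi}"
    by (rule prob_space_uniform_measure) auto
  show "prob_space steinhaus"
    unfolding steinhaus_def by (rule prob_space_distr[OF cis_borel_measurable])
  show "sets steinhaus = sets borel"
    by (simp add: steinhaus_def)
  show "AE w in steinhaus. norm w = 1"
    unfolding steinhaus_def by (subst AE_distr_iff[OF cis_borel_measurable]) auto
qed

lemma steinhaus_orthonormal:
  "(\<integral>w. w ^ j * cnj w ^ k \<partial>steinhaus) = (if j = k then 1 else 0)"
proof -
  \<comment> \<open>Taken as a real number because the difference of the exponents may be
    negative.\<close>
  define m where "m = real j - real k"
  have "(\<integral>w. w ^ j * cnj w ^ k \<partial>steinhaus)
      = (\<integral>t. cis t ^ j * cnj (cis t) ^ k \<partial>uniform_measure lborel {0..2 * pi})"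
    unfolding steinhaus_def
    by (subst integral_distr) (auto intro!: borel_measurable_continuous_onI continuous_intros cis_borel_measurable)
  also have "(\<lambda>t. cis t ^ j * cnj (cis t) ^ k) = (\<lambda>t. cis (m * t))"
    by (simp only: cis_cnj Complex.DeMoivre cis_mult m_def) (simp add: algebra_simps)
  also have "(\<integral>t. cis (m * t) \<partial>uniform_measure lborel {0..2 * pi})
      = (\<integral>t. (indicator {0..2 * pi} t / (2 * pi)) *\<^sub>R cis (m * t) \<partial>lborel)"
  proof -
    have "uniform_measure lborel {0..2 * pi}
        = density lborel (\<lambda>t. ennreal (indicator {0..2 * pi} t / (2 * pi)))"
      unfolding uniform_measure_def
      by (intro density_cong AE_I2)
        (auto simp: divide_ennreal [symmetric] ennreal_indicator split: split_indicator)
    moreover have "(\<lambda>t. cis (m * t)) \<in> borel_measurable lborel"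
    proof -
      have "(\<lambda>t. cis (m * t)) \<in> borel_measurable borel"
        by (intro borel_measurable_continuous_onI continuous_intros)
      then show ?thesis by simp
    qed
    ultimately show ?thesis
      by (simp only:) (subst integral_density, auto)
  qed
  also have "\<dots> = (\<integral>t. (1 / (2 * pi)) *\<^sub>R (indicator {0..2 * pi} t *\<^sub>R cis (m * t)) \<partial>lborel)"
    by simp
  also have "\<dots> = (1 / (2 * pi)) *\<^sub>R (\<integral>t. indicator {0..2 * pi} t *\<^sub>R cis (m * t) \<partial>lborel)"
    by (rule integral_scaleR_right)
  also have "(\<integral>t. indicator {0..2 * pi} t *\<^sub>R cis (m * t) \<partial>lborel)
      = (if j = k then 2 * of_real pi else 0)"
  proof (cases "j = k")
    case True
    have "(\<integral>t. indicator {0..2 * pi} t *\<^sub>R cis (m * t) \<partial>lborel)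
        = of_real (2 * pi) - (of_real 0 :: complex)"
      unfolding m_def True
      by (rule integral_FTC_atLeastAtMost[where F = "\<lambda>t. of_real t"])
        (auto intro!: derivative_eq_intros continuous_intros)
    then show ?thesis using True by simp
  next
    case False
    then have m: "m \<noteq> 0" by (simp add: m_def)
    have "(\<integral>t. indicator {0..2 * pi} t *\<^sub>R cis (m * t) \<partial>lborel)
        = cis (m * (2 * pi)) / (\<i> * of_real m) - cis (m * 0) / (\<i> * of_real m)"
    proof (rule integral_FTC_atLeastAtMost[where F = "\<lambda>t. cis (m * t) / (\<i> * of_real m)"])
      fix t :: real
      have "((\<lambda>z. exp (\<i> * of_real m * z) / (\<i> * of_real m)) has_field_derivative
          exp (\<i> * of_real m * of_real t)) (at (of_real t))"
        using m by (auto intro!: derivative_eq_intros)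
      from has_vector_derivative_real_field[OF this]
      show "((\<lambda>t. cis (m * t) / (\<i> * of_real m)) has_vector_derivative cis (m * t))
          (at t within {0..2 * pi})"
        by (simp add: cis_conv_exp mult.assoc)
    qed (auto intro!: continuous_intros)
    also have "cis (m * (2 * pi)) = cis (2 * pi * of_int (int j - int k))"
      by (simp add: m_def mult_ac)
    also have "\<dots> = 1"
      by (rule cis_multiple_2pi) simp
    finally show ?thesis using False by simp
  qed
  finally show ?thesis
    by (auto simp: scaleR_conv_of_real)
qed

lemma eval_fps_bound:
  assumes "abs_summable_fps b" "norm z \<le> 1"
  shows "norm (\<Sum>k<N. fps_nth b k * z ^ k) \<le> (\<Sum>k. norm (fps_nth b k))"
proof -
  have "norm (\<Sum>k<N. fps_nth b k * z ^ k) \<le> (\<Sum>k<N. norm (fps_nth b k))"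
    by (intro sum_norm_le)
      (use assms in \<open>auto simp: norm_mult norm_power mult_left_le power_le_one\<close>)
  also have "\<dots> \<le> (\<Sum>k. norm (fps_nth b k))"
    using assms unfolding abs_summable_fps_def by (intro sum_le_suminf) auto
  finally show ?thesis .
qed

lemma steinhaus_integrable_bounded:
  fixes f :: "complex \<Rightarrow> 'b::{banach, second_countable_topology}"
  assumes "f \<in> borel_measurable borel" "\<And>w. norm w = 1 \<Longrightarrow> norm (f w) \<le> B"
  shows "integrable steinhaus f"
proof -
  interpret prob_space steinhaus by (rule prob_space_steinhaus)
  show ?thesis
    by (rule integrable_const_bound[of _ B])
      (use AE_steinhaus assms in \<open>auto elim: eventually_mono\<close>)
qed

lemma steinhaus_parseval_poly:
  "(\<integral>w. (norm (\<Sum>k<N. b k * w ^ k))\<^sup>2 \<partial>steinhaus) = (\<Sum>k<N. (norm (b k :: complex))\<^sup>2)"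
proof -
  have int: "integrable steinhaus (\<lambda>w. w ^ j * cnj w ^ k)" for j k
    by (rule steinhaus_integrable_bounded[of _ 1])
      (auto simp: norm_mult norm_power intro!: borel_measurable_continuous_onI continuous_intros)
  have "complex_of_real (\<integral>w. (norm (\<Sum>k<N. b k * w ^ k))\<^sup>2 \<partial>steinhaus)
      = (\<integral>w. complex_of_real ((norm (\<Sum>k<N. b k * w ^ k))\<^sup>2) \<partial>steinhaus)"
    by (rule integral_complex_of_real [symmetric])
  also have "\<dots> = (\<integral>w. (\<Sum>j<N. \<Sum>k<N. (b j * cnj (b k)) * (w ^ j * cnj w ^ k)) \<partial>steinhaus)"
    by (simp only: complex_norm_square cnj_sum sum_product)
      (simp add: algebra_simps)
  also have "\<dots> = (\<Sum>j<N. \<Sum>k<N. (b j * cnj (b k)) * (if j = k then 1 else 0))"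
    using int by (simp add: steinhaus_orthonormal)
  also have "\<dots> = (\<Sum>j<N. b j * cnj (b j))"
    by (simp add: if_distrib[of "(*) _"] cong: if_cong)
  also have "\<dots> = complex_of_real (\<Sum>k<N. (norm (b k))\<^sup>2)"
    by (simp only: complex_norm_square of_real_sum)
  finally show ?thesis
    by (simp only: of_real_eq_iff)
qed

text \<open>Parseval for the truncated series passes to the limit by dominated convergence, with the
  sum of the moduli of the coefficients as bound. The coefficient sums increase, so each stays below
  the limit.\<close>

lemma steinhaus_bessel:
  assumes b: "abs_summable_fps b"
  shows "(\<Sum>k<d. (norm (fps_nth b k))\<^sup>2) \<le> (\<integral>w. (norm (eval_fps b w))\<^sup>2 \<partial>steinhaus)"
proof -
  interpret prob_space steinhaus by (rule prob_space_steinhaus)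
  define B where "B = (\<Sum>k. norm (fps_nth b k))"
  have lim: "(\<lambda>N. \<Sum>k<N. fps_nth b k * w ^ k) \<longlonglongrightarrow> eval_fps b w" if "norm w = 1" for w
    using summable_norm_cancel[OF abs_summable_fps_terms[OF b, of w]] that
    unfolding eval_fps_def by (intro summable_LIMSEQ) auto
  have meas: "(\<lambda>w. \<Sum>k<N. fps_nth b k * w ^ k) \<in> borel_measurable steinhaus" for N
    by (intro borel_measurable_sum) measurable
  have "(\<lambda>N. \<integral>w. (norm (\<Sum>k<N. fps_nth b k * w ^ k))\<^sup>2 \<partial>steinhaus)
      \<longlonglongrightarrow> (\<integral>w. (norm (eval_fps b w))\<^sup>2 \<partial>steinhaus)"
  proof (rule integral_dominated_convergence[where w = "\<lambda>_. B\<^sup>2"])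
    show "(\<lambda>w. (norm (eval_fps b w))\<^sup>2) \<in> borel_measurable steinhaus"
      unfolding eval_fps_def by measurable
    show "(\<lambda>w. (norm (\<Sum>k<N. fps_nth b k * w ^ k))\<^sup>2) \<in> borel_measurable steinhaus" for N
      using meas[of N] by measurable
    show "AE w in steinhaus. (\<lambda>N. (norm (\<Sum>k<N. fps_nth b k * w ^ k))\<^sup>2)
        \<longlonglongrightarrow> (norm (eval_fps b w))\<^sup>2"
      using AE_steinhaus by eventually_elim (intro tendsto_intros lim)
    show "AE w in steinhaus. norm ((norm (\<Sum>k<N. fps_nth b k * w ^ k))\<^sup>2) \<le> B\<^sup>2" for N
      using AE_steinhaus
      by eventually_elim (use eval_fps_bound[OF b] in \<open>auto simp: B_def intro!: power_mono\<close>)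
  qed auto
  then have "(\<lambda>N. \<Sum>k<N. (norm (fps_nth b k))\<^sup>2) \<longlonglongrightarrow> (\<integral>w. (norm (eval_fps b w))\<^sup>2 \<partial>steinhaus)"
    by (simp only: steinhaus_parseval_poly)
  then show ?thesis
    by (rule incseq_le[rotated]) (auto simp: incseq_def intro!: sum_mono2)
qed

text \<open>Carleman's inequality: Cauchy--Schwarz applied to the convolution \<open>p = b * c\<close>, where
  \<open>|b|\<^sup>2 = |c|\<^sup>2 = |p|\<close> on the circle; the weight \<open>2 ^ k\<close> absorbs the \<open>k + 1\<close> terms.\<close>
lemma weissler_1:
  "sqrt (\<Sum>k<d. (norm (a k))\<^sup>2)
     \<le> (\<integral>w. norm (\<Sum>k<d. complex_of_real (sqrt 2 ^ k) * w ^ k * a k) \<partial>steinhaus)"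
proof -
  define p where "p = (\<Sum>k<d. monom (complex_of_real (sqrt 2 ^ k) * a k) k)"
  have coeff_p: "coeff p k = complex_of_real (sqrt 2 ^ k) * a k" if "k < d" for k
    using that by (simp add: p_def coeff_sum)
  have poly_p: "poly p w = (\<Sum>k<d. complex_of_real (sqrt 2 ^ k) * w ^ k * a k)" for w
    by (simp add: p_def poly_sum poly_monom mult_ac)
  obtain b c where bc: "balanced_factors p b c"
    using balanced_factors_exist by blast
  let ?I = "\<integral>w. norm (poly p w) \<partial>steinhaus"
  have le_I: "(\<Sum>k<d. (norm (fps_nth b k))\<^sup>2) \<le> ?I" "(\<Sum>k<d. (norm (fps_nth c k))\<^sup>2) \<le> ?I"
  proof -
    have eq: "(\<integral>w. (norm (eval_fps e w))\<^sup>2 \<partial>steinhaus) = ?I" if "e = b \<or> e = c" for e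
    proof (rule integral_cong_AE)
      show "AE w in steinhaus. (norm (eval_fps e w))\<^sup>2 = norm (poly p w)"
        using AE_steinhaus
        by eventually_elim (use bc that in \<open>auto simp: balanced_factors_def\<close>)
      show "(\<lambda>w. (norm (eval_fps e w))\<^sup>2) \<in> borel_measurable steinhaus"
        unfolding eval_fps_def by measurable
    qed (simp add: poly_p)
    show "(\<Sum>k<d. (norm (fps_nth b k))\<^sup>2) \<le> ?I" "(\<Sum>k<d. (norm (fps_nth c k))\<^sup>2) \<le> ?I"
      using steinhaus_bessel[of b d] steinhaus_bessel[of c d] bc eq[of b] eq[of c]
      by (auto simp: balanced_factors_def)
  qed
  define \<beta> where "\<beta> k = (norm (fps_nth b k))\<^sup>2" for k
  define \<gamma> where "\<gamma> k = (norm (fps_nth c k))\<^sup>2" for k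
  have coeff_le: "(norm (a k))\<^sup>2 \<le> (\<Sum>i\<le>k. \<beta> i * \<gamma> (k - i))" if "k < d" for k
  proof -
    have "coeff p k = (\<Sum>i\<le>k. fps_nth b i * fps_nth c (k - i))"
    proof -
      have "fps_of_poly p = b * c"
        using bc by (simp add: balanced_factors_def)
      then have "coeff p k = fps_nth (b * c) k"
        by (metis fps_of_poly_nth)
      then show ?thesis
        by (simp add: fps_mult_nth atMost_atLeast0)
    qed
    then have "norm (coeff p k) \<le> (\<Sum>i\<le>k. norm (fps_nth b i) * norm (fps_nth c (k - i)))"
      by (auto simp: norm_mult intro!: order_trans[OF norm_sum])
    then have "(norm (coeff p k))\<^sup>2
        \<le> (\<Sum>i\<le>k. 1 * (norm (fps_nth b i) * norm (fps_nth c (k - i))))\<^sup>2"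
      by (intro power_mono) auto
    also have "\<dots> \<le> (\<Sum>i\<le>k. 1\<^sup>2) * (\<Sum>i\<le>k. (norm (fps_nth b i) * norm (fps_nth c (k - i)))\<^sup>2)"
      by (rule Cauchy_Schwarz_ineq_sum)
    also have "\<dots> = real (Suc k) * (\<Sum>i\<le>k. \<beta> i * \<gamma> (k - i))"
      by (simp add: \<beta>_def \<gamma>_def power_mult_distrib)
    also have "\<dots> \<le> 2 ^ k * (\<Sum>i\<le>k. \<beta> i * \<gamma> (k - i))"
    proof (rule mult_right_mono)
      have "Suc k \<le> 2 ^ k" by (induction k) auto
      then show "real (Suc k) \<le> 2 ^ k"
        by (metis of_nat_le_iff of_nat_numeral of_nat_power)
    qed (auto simp: \<beta>_def \<gamma>_def intro!: sum_nonneg)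
    \<comment> \<open>The weight \<open>sqrt 2 ^ k\<close> in \<open>p\<close> squares to exactly
      the factor \<open>2 ^ k\<close> on the right, so both cancel.\<close>
    finally have "2 ^ k * (norm (a k))\<^sup>2 \<le> 2 ^ k * (\<Sum>i\<le>k. \<beta> i * \<gamma> (k - i))"
      by (simp add: coeff_p[OF that] norm_mult norm_power power_mult_distrib
          power_mult [symmetric] mult.commute[of _ 2] power_mult[of "sqrt 2" 2])
    then show ?thesis by simp
  qed
  have "(\<Sum>k<d. (norm (a k))\<^sup>2) \<le> (\<Sum>k<d. \<Sum>i\<le>k. \<beta> i * \<gamma> (k - i))"
    by (intro sum_mono coeff_le) auto
  \<comment> \<open>Enlarging the triangle \<open>i + j < d\<close> to a square turns the double sum
    into a product.\<close>
  also have "\<dots> \<le> (\<Sum>i<d. \<Sum>j<d. \<beta> i * \<gamma> j)"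
  proof -
    have "(\<Sum>k<d. \<Sum>i\<le>k. \<beta> i * \<gamma> (k - i)) = (\<Sum>(i, j) | i + j < d. \<beta> i * \<gamma> j)"
      by (rule sum.triangle_reindex [symmetric])
    also have "\<dots> \<le> (\<Sum>(i, j) \<in> {..<d} \<times> {..<d}. \<beta> i * \<gamma> j)"
      by (rule sum_mono2) (auto simp: \<beta>_def \<gamma>_def)
    finally show ?thesis by (simp add: sum.cartesian_product)
  qed
  also have "\<dots> = (\<Sum>i<d. \<beta> i) * (\<Sum>j<d. \<gamma> j)"
    by (simp add: sum_product)
  also have "\<dots> \<le> ?I * ?I"
    using le_I by (intro mult_mono) (auto simp: \<beta>_def \<gamma>_def intro!: sum_nonneg)
  finally have "sqrt (\<Sum>k<d. (norm (a k))\<^sup>2) \<le> ?I"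
    by (intro real_le_lsqrt) (auto simp: power2_eq_square intro!: sum_nonneg)
  then show ?thesis by (simp only: poly_p)
qed

section \<open>Hypercontractivity on the torus\<close>

text \<open>Proved by duality: the vector of integrals is paired with itself, Cauchy--Schwarz is
  applied under the integral sign, and one factor \<open>S\<close> is cancelled.\<close>

lemma minkowski_integral:
  fixes f :: "'k \<Rightarrow> 'b \<Rightarrow> real"
  assumes "finite K" and int: "\<And>k. k \<in> K \<Longrightarrow> integrable M (f k)"
  shows "integrable M (\<lambda>x. sqrt (\<Sum>k\<in>K. (f k x)\<^sup>2))"
    and "sqrt (\<Sum>k\<in>K. (\<integral>x. f k x \<partial>M)\<^sup>2) \<le> (\<integral>x. sqrt (\<Sum>k\<in>K. (f k x)\<^sup>2) \<partial>M)"
proof -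
  have meas: "\<And>k. k \<in> K \<Longrightarrow> f k \<in> borel_measurable M"
    using int by blast
  show int': "integrable M (\<lambda>x. sqrt (\<Sum>k\<in>K. (f k x)\<^sup>2))"
  proof (rule Bochner_Integration.integrable_bound)
    show "integrable M (\<lambda>x. \<Sum>k\<in>K. \<bar>f k x\<bar>)"
      using int by auto
    show "(\<lambda>x. sqrt (\<Sum>k\<in>K. (f k x)\<^sup>2)) \<in> borel_measurable M"
      using meas by measurable
    show "AE x in M. norm (sqrt (\<Sum>k\<in>K. (f k x)\<^sup>2)) \<le> norm (\<Sum>k\<in>K. \<bar>f k x\<bar>)"
      using L2_set_le_sum_abs[of _ K] by (auto simp: L2_set_def sum_nonneg)
  qed
  define v where "v k = (\<integral>x. f k x \<partial>M)" for k
  define S where "S = sqrt (\<Sum>k\<in>K. (v k)\<^sup>2)"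
  let ?R = "\<integral>x. sqrt (\<Sum>k\<in>K. (f k x)\<^sup>2) \<partial>M"
  have "S * S = (\<Sum>k\<in>K. v k * (\<integral>x. f k x \<partial>M))"
    by (simp add: S_def v_def power2_eq_square sum_nonneg)
  also have "\<dots> = (\<integral>x. (\<Sum>k\<in>K. v k * f k x) \<partial>M)"
    using int by simp
  also have "\<dots> \<le> (\<integral>x. S * sqrt (\<Sum>k\<in>K. (f k x)\<^sup>2) \<partial>M)"
  proof (rule integral_mono)
    show "(\<Sum>k\<in>K. v k * f k x) \<le> S * sqrt (\<Sum>k\<in>K. (f k x)\<^sup>2)" for x
    proof -
      have "(\<Sum>k\<in>K. v k * f k x) \<le> (\<Sum>k\<in>K. \<bar>v k\<bar> * \<bar>f k x\<bar>)"
        by (intro sum_mono) (metis abs_ge_self abs_mult)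
      also have "\<dots> \<le> S * sqrt (\<Sum>k\<in>K. (f k x)\<^sup>2)"
        using L2_set_mult_ineq[of v "\<lambda>k. f k x" K] by (simp add: L2_set_def S_def)
      finally show ?thesis .
    qed
  qed (use int int' in auto)
  also have "\<dots> = S * ?R"
    by simp
  finally have "S * S \<le> S * ?R" .
  moreover have "S \<ge> 0" "?R \<ge> 0"
    by (auto simp: S_def sum_nonneg)
  ultimately have "S \<le> ?R"
    by (cases "S = 0") (auto simp: mult_le_cancel_left)
  then show "sqrt (\<Sum>k\<in>K. (\<integral>x. f k x \<partial>M)\<^sup>2) \<le> ?R"
    by (simp add: S_def v_def)
qed

section \<open>Weighted polynomials on the torus\<close>

abbreviation torus :: "nat \<Rightarrow> (nat \<Rightarrow> complex) measure" where
  "torus n \<equiv> PiM {..<n} (\<lambda>_. steinhaus)"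

lemma prob_space_torus: "prob_space (torus n)"
  by (intro prob_space_PiM prob_space_steinhaus)

lemma AE_torus: "AE w in torus n. \<forall>i<n. norm (w i) = 1"
proof -
  have "AE w in torus n. \<forall>i\<in>{..<n}. norm (w i) = 1"
    by (intro AE_finite_allI AE_PiM_component[OF prob_space_steinhaus] AE_steinhaus) auto
  then show ?thesis by eventually_elim simp
qed

lemma norm_mpow:
  assumes "\<forall>i<n. norm (w i) = 1"
  shows "norm (mpow n w \<alpha>) = 1"
  using assms by (simp add: mpow_def norm_power prod_norm [symmetric])

lemma mpow_measurable [measurable]: "(\<lambda>w. mpow n w \<alpha>) \<in> borel_measurable (torus n)"
  unfolding mpow_def by measurable

lemma torus_integrable_bounded:
  fixes f :: "(nat \<Rightarrow> complex) \<Rightarrow> 'b::{banach, second_countable_topology}"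
  assumes "f \<in> borel_measurable (torus n)"
    and "\<And>w. \<forall>i<n. norm (w i) = 1 \<Longrightarrow> norm (f w) \<le> B"
  shows "integrable (torus n) f"
proof -
  interpret prob_space "torus n" by (rule prob_space_torus)
  show ?thesis
    by (rule integrable_const_bound[of _ B])
      (use AE_torus[of n] assms in \<open>auto elim: eventually_mono\<close>)
qed

text \<open>Only the entries of \<alpha> below \<open>n\<close> enter the weight and the monomial.
  Longer indices can therefore be passed down an induction on \<open>n\<close> without truncating
  them.\<close>

definition torus_poly ::
  "(nat \<Rightarrow> nat) set \<Rightarrow> ((nat \<Rightarrow> nat) \<Rightarrow> complex) \<Rightarrow> nat \<Rightarrow> (nat \<Rightarrow> complex) \<Rightarrow> complex" where
  "torus_poly A a n w = (\<Sum>\<alpha>\<in>A. complex_of_real (sqrt 2 ^ mabs n \<alpha>) * mpow n w \<alpha> * a \<alpha>)"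

lemma torus_poly_measurable [measurable]: "torus_poly A a n \<in> borel_measurable (torus n)"
  unfolding torus_poly_def by measurable

lemma norm_torus_poly_le:
  assumes "\<forall>i<n. norm (w i) = 1"
  shows "norm (torus_poly A a n w) \<le> (\<Sum>\<alpha>\<in>A. sqrt 2 ^ mabs n \<alpha> * norm (a \<alpha>))"
  unfolding torus_poly_def
  by (intro sum_norm_le) (simp add: norm_mult norm_power norm_mpow[OF assms])

lemma torus_poly_integrable: "integrable (torus n) (\<lambda>w. norm (torus_poly A a n w))"
proof (rule torus_integrable_bounded)
  show "norm (norm (torus_poly A a n w)) \<le> (\<Sum>\<alpha>\<in>A. sqrt 2 ^ mabs n \<alpha> * norm (a \<alpha>))"
    if "\<forall>i<n. norm (w i) = 1" for w
    using norm_torus_poly_le[OF that] by simp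
qed measurable

text \<open>Collecting monomials by the exponent \<open>k\<close> of the last variable leaves a
  polynomial in \<open>z\<close> of the shape treated by \<open>weissler_1\<close>, with functions
  of \<open>w\<close> as coefficients.\<close>

lemma torus_poly_Suc:
  assumes "finite A" "\<forall>\<alpha>\<in>A. \<alpha> n < d"
  shows "torus_poly A a (Suc n) (w(n := z)) =
    (\<Sum>k<d. complex_of_real (sqrt 2 ^ k) * z ^ k * torus_poly {\<alpha>\<in>A. \<alpha> n = k} a n w)"
proof -
  have "torus_poly A a (Suc n) (w(n := z)) =
      (\<Sum>\<alpha>\<in>A. complex_of_real (sqrt 2 ^ \<alpha> n) * z ^ \<alpha> n *
        (complex_of_real (sqrt 2 ^ mabs n \<alpha>) * mpow n w \<alpha> * a \<alpha>))"
    unfolding torus_poly_def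
    by (intro sum.cong refl) (simp add: mabs_def mpow_def power_add)
  also have "\<dots> = (\<Sum>k<d. \<Sum>\<alpha>\<in>{\<alpha>\<in>A. \<alpha> n = k}. complex_of_real (sqrt 2 ^ \<alpha> n) * z ^ \<alpha> n *
        (complex_of_real (sqrt 2 ^ mabs n \<alpha>) * mpow n w \<alpha> * a \<alpha>))"
    using assms by (intro sum.group [symmetric]) auto
  also have "\<dots> = (\<Sum>k<d. complex_of_real (sqrt 2 ^ k) * z ^ k * torus_poly {\<alpha>\<in>A. \<alpha> n = k} a n w)"
    unfolding torus_poly_def sum_distrib_left by (intro sum.cong refl) auto
  finally show ?thesis .
qed

text \<open>Tensorization of \<open>weissler_1\<close> by Minkowski's inequality. Only the restrictions of the
  indices in \<open>A\<close> to \<open>{..<n}\<close> matter; injectivity of this restriction is what the induction keeps.\<close>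
lemma weissler_n:
  assumes "finite A" "\<forall>\<alpha>\<in>A. \<forall>\<beta>\<in>A. (\<forall>i<n. \<alpha> i = \<beta> i) \<longrightarrow> \<alpha> = \<beta>"
  shows "sqrt (\<Sum>\<alpha>\<in>A. (norm (a \<alpha>))\<^sup>2) \<le> (\<integral>w. norm (torus_poly A a n w) \<partial>torus n)"
  using assms
proof (induction n arbitrary: A)
  case 0
  interpret prob_space "torus 0" by (rule prob_space_torus)
  \<comment> \<open>With no variables the hypothesis identifies all indices, so \<open>A\<close> has
    at most one element.\<close>
  have eq: "\<alpha> = \<beta>" if "\<alpha> \<in> A" "\<beta> \<in> A" for \<alpha> \<beta>
    using 0 that by simp
  show ?case
  proof (cases "A = {}")
    case False
    then obtain \<alpha> where "\<alpha> \<in> A" by blast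
    then have "A = {\<alpha>}" using eq by blast
    then show ?thesis
      using prob_space by (simp add: torus_poly_def mabs_def mpow_def)
  qed (simp add: torus_poly_def)
next
  case (Suc n)
  interpret T: product_sigma_finite "\<lambda>_::nat. steinhaus"
    by (intro product_sigma_finite.intro prob_space_imp_sigma_finite prob_space_steinhaus)
  interpret S: prob_space steinhaus by (rule prob_space_steinhaus)
  \<comment> \<open>A strict bound for the last exponents; inserting \<open>0\<close> keeps
    \<open>Max\<close> meaningful when \<open>A\<close> is empty.\<close>
  define d where "d = Suc (Max (insert 0 ((\<lambda>\<alpha>. \<alpha> n) ` A)))"
  have d: "\<forall>\<alpha>\<in>A. \<alpha> n < d"
    using \<open>finite A\<close> by (auto simp: d_def less_Suc_eq_le intro!: Max_ge)
  define G where "G k = torus_poly {\<alpha>\<in>A. \<alpha> n = k} a n" for k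
  let ?F = "torus_poly A a (Suc n)"
  define B where "B = (\<Sum>\<alpha>\<in>A. sqrt 2 ^ mabs (Suc n) \<alpha> * norm (a \<alpha>))"
  have intG: "integrable (torus n) (\<lambda>w. norm (G k w))" for k
    unfolding G_def by (rule torus_poly_integrable)
  have intF: "integrable (torus (Suc n)) (\<lambda>w. norm (?F w))"
    by (rule torus_poly_integrable)
  have F_upd: "?F (w(n := z)) = (\<Sum>k<d. complex_of_real (sqrt 2 ^ k) * z ^ k * G k w)" for w z
    unfolding G_def by (rule torus_poly_Suc[OF \<open>finite A\<close> d])
  have [measurable]: "G k \<in> borel_measurable (torus n)" for k
    unfolding G_def by measurable
  have int_inner: "integrable (torus n) (\<lambda>w. \<integral>z. norm (?F (w(n := z))) \<partial>steinhaus)"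
  proof (rule torus_integrable_bounded[where B = B])
    show "(\<lambda>w. \<integral>z. norm (?F (w(n := z))) \<partial>steinhaus) \<in> borel_measurable (torus n)"
      unfolding F_upd by (rule sigma_finite_measure.borel_measurable_lebesgue_integral[OF
            prob_space_imp_sigma_finite[OF prob_space_steinhaus]]) measurable
  next
    fix w :: "nat \<Rightarrow> complex"
    assume w: "\<forall>i<n. norm (w i) = 1"
    have le: "AE z in steinhaus. norm (?F (w(n := z))) \<le> B"
      using AE_steinhaus unfolding B_def
      by eventually_elim (rule norm_torus_poly_le, use w in \<open>auto simp: less_Suc_eq\<close>)
    have "(\<integral>z. norm (?F (w(n := z))) \<partial>steinhaus) \<le> (\<integral>z. B \<partial>steinhaus)"
      by (rule integral_mono_AE) (use le in \<open>simp_all add: F_upd S.integrable_const_bound[of _ B]\<close>)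
    then show "norm (\<integral>z. norm (?F (w(n := z))) \<partial>steinhaus) \<le> B"
      by (simp add: S.prob_space)
  qed
  have "sqrt (\<Sum>\<alpha>\<in>A. (norm (a \<alpha>))\<^sup>2) = sqrt (\<Sum>k<d. \<Sum>\<alpha>\<in>{\<alpha>\<in>A. \<alpha> n = k}. (norm (a \<alpha>))\<^sup>2)"
    using Suc.prems d by (subst sum.group) auto
  also have "\<dots> \<le> sqrt (\<Sum>k<d. (\<integral>w. norm (G k w) \<partial>torus n)\<^sup>2)"
  proof (intro real_sqrt_le_mono sum_mono)
    fix k
    \<comment> \<open>Indices in one slice agree at \<open>n\<close>, so they are still separated by
      their entries below \<open>n\<close>.\<close>
    have "sqrt (\<Sum>\<alpha>\<in>{\<alpha>\<in>A. \<alpha> n = k}. (norm (a \<alpha>))\<^sup>2) \<le> (\<integral>w. norm (G k w) \<partial>torus n)"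
      unfolding G_def using Suc.prems by (intro Suc.IH) (auto simp: less_Suc_eq)
    then show "(\<Sum>\<alpha>\<in>{\<alpha>\<in>A. \<alpha> n = k}. (norm (a \<alpha>))\<^sup>2) \<le> (\<integral>w. norm (G k w) \<partial>torus n)\<^sup>2"
      by (rule sqrt_le_D)
  qed
  also have "\<dots> \<le> (\<integral>w. sqrt (\<Sum>k<d. (norm (G k w))\<^sup>2) \<partial>torus n)"
    by (intro minkowski_integral intG) auto
  \<comment> \<open>For each fixed \<open>w\<close>, \<open>weissler_1\<close> is applied in the
    last variable to the coefficients \<open>G k w\<close>.\<close>
  also have "\<dots> \<le> (\<integral>w. (\<integral>z. norm (?F (w(n := z))) \<partial>steinhaus) \<partial>torus n)"
    unfolding F_upd
    by (intro integral_mono minkowski_integral intG int_inner[unfolded F_upd] weissler_1) simp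
  also have "\<dots> = (\<integral>w. norm (?F w) \<partial>torus (Suc n))"
    using T.product_integral_insert[of "{..<n}" n "\<lambda>w. norm (?F w)"] intF
    by (simp add: lessThan_Suc)
  finally show ?case .
qed

section \<open>Rademacher sums are dominated by Gaussian sums\<close>

text \<open>Splits a complex Gaussian multiple of \<open>x\<close> into real ones along
  \<open>x\<close> and \<open>cmul \<i> x\<close>; it also exhibits continuity in the
  scalar.\<close>

lemma complex_banach_decomp:
  assumes "complex_banach cmul"
  shows "cmul c x = Re c *\<^sub>R x + Im c *\<^sub>R cmul \<i> x"
proof -
  have "cmul c x = cmul (complex_of_real (Re c) + complex_of_real (Im c) * \<i>) x"
    by (subst (1) complex_eq) (simp only: mult.commute)
  then show ?thesis
    using assms by (simp add: complex_banach_def)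
qed

text \<open>The space need not be separable, so \<open>borel_measurable_add\<close> is not available for vector-valued
  maps. The norm is instead viewed as a continuous function of the countably many coefficients.\<close>
lemma norm_random_sum_measurable:
  assumes cb: "complex_banach cmul" and "finite I"
    and f: "\<And>i. i \<in> I \<Longrightarrow> f i \<in> borel_measurable M"
  shows "(\<lambda>\<omega>. norm (y + (\<Sum>i\<in>I. cmul (f i \<omega>) (x i)))) \<in> borel_measurable M"
proof -
  obtain h where h: "bij_betw h {..<card I} I"
    using ex_bij_betw_nat_finite[OF \<open>finite I\<close>] by (auto simp: atLeast0LessThan)
  define \<Phi> :: "(nat \<Rightarrow> complex) \<Rightarrow> real"
    where "\<Phi> g = norm (y + (\<Sum>k<card I. cmul (g k) (x (h k))))" for g
  \<comment> \<open>Padding with \<open>0\<close> gives a map into the space of all complex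
    sequences, where the product and the Borel sigma-algebras agree.\<close>
  define G where "G \<omega> = (\<lambda>k. if k < card I then f (h k) \<omega> else 0)" for \<omega>
  have "\<Phi> \<in> borel_measurable borel"
    unfolding \<Phi>_def complex_banach_decomp[OF cb, of "_ (_ :: nat)"]
    by (intro borel_measurable_continuous_onI continuous_intros continuous_on_product_coordinates)
  moreover have "G \<in> measurable M borel"
  proof -
    have "G \<in> measurable M (PiM UNIV (\<lambda>_. borel))"
    proof (rule measurable_PiM_single')
      fix k :: nat
      have "f (h k) \<in> borel_measurable M" if "k < card I"
        using that h by (intro f) (auto simp: bij_betw_def)
      then show "(\<lambda>\<omega>. G \<omega> k) \<in> borel_measurable M"
        unfolding G_def by (cases "k < card I") auto
    qed auto
    then show ?thesis
      by (simp add: measurable_cong_sets[OF refl sets_PiM_equal_borel])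
  qed
  ultimately have "(\<lambda>\<omega>. \<Phi> (G \<omega>)) \<in> borel_measurable M"
    by (rule measurable_compose[rotated])
  moreover have "(\<Sum>k<card I. cmul (G \<omega> k) (x (h k))) = (\<Sum>i\<in>I. cmul (f i \<omega>) (x i))" for \<omega>
    by (subst sum.reindex_bij_betw[OF h, symmetric]) (simp add: G_def)
  ultimately show ?thesis
    by (simp add: \<Phi>_def)
qed

section \<open>Real Gaussian averages and Jensen's inequality\<close>

abbreviation real_gauss :: "real measure" where
  "real_gauss \<equiv> density lborel (normal_density 0 (1 / sqrt 2))"

lemma prob_space_real_gauss: "prob_space real_gauss"
  by (rule prob_space_normal_density) simp

text \<open>The real and imaginary parts of a standard complex Gaussian have standard deviation
  \<open>1 / sqrt 2\<close>. The mean modulus \<open>1 / sqrt pi\<close> is the source of the factor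
  \<open>sqrt pi\<close> in the final constant.\<close>

lemma real_gauss_moments:
  shows "integrable real_gauss (\<lambda>t. t)" "(\<integral>t. t \<partial>real_gauss) = 0"
    and "integrable real_gauss (\<lambda>t. t\<^sup>2)"
    and "integrable real_gauss (\<lambda>t. \<bar>t\<bar>)" "(\<integral>t. \<bar>t\<bar> \<partial>real_gauss) = 1 / sqrt pi"
proof -
  have s: "1 / sqrt 2 > (0 :: real)" by simp
  show "integrable real_gauss (\<lambda>t. t)"
    using integrable_normal_moment[OF s, of 0 1] by (simp add: integrable_density)
  show "(\<integral>t. t \<partial>real_gauss) = 0"
    using integral_normal_moment_odd[OF s, of 0 0] by (simp add: integral_density)
  show "integrable real_gauss (\<lambda>t. t\<^sup>2)"
    using integrable_normal_moment[OF s, of 0 2] by (simp add: integrable_density)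
  show "integrable real_gauss (\<lambda>t. \<bar>t\<bar>)"
    using integrable_normal_moment_abs[OF s, of 0 1] by (simp add: integrable_density)
  show "(\<integral>t. \<bar>t\<bar> \<partial>real_gauss) = 1 / sqrt pi"
    using integral_normal_moment_abs_odd[OF s, of 0 0]
    by (simp add: integral_density real_sqrt_divide)
qed

lemma real_gauss_reflect:
  fixes f :: "real \<Rightarrow> real"
  assumes [measurable]: "f \<in> borel_measurable borel"
  shows "(\<integral>t. f (- t) \<partial>real_gauss) = (\<integral>t. f t \<partial>real_gauss)"
proof -
  have "(\<integral>t. f t \<partial>real_gauss) = (\<integral>t. normal_density 0 (1 / sqrt 2) t * f t \<partial>lborel)"
    by (simp add: integral_density)
  also have "\<dots> = (\<integral>t. normal_density 0 (1 / sqrt 2) (- t) * f (- t) \<partial>lborel)"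
    using lborel_integral_real_affine[of "- 1" "\<lambda>t. normal_density 0 (1 / sqrt 2) t * f t" 0] by simp
  also have "\<dots> = (\<integral>t. normal_density 0 (1 / sqrt 2) t * f (- t) \<partial>lborel)"
    by (simp add: normal_density_def)
  also have "\<dots> = (\<integral>t. f (- t) \<partial>real_gauss)"
    by (simp add: integral_density)
  finally show ?thesis by simp
qed

lemma convex_on_norm_affine_square:
  fixes x y :: "'a::real_normed_vector"
  shows "convex_on UNIV (\<lambda>t. (norm (y + t *\<^sub>R x))\<^sup>2)"
proof (rule convex_onI)
  fix s t u :: real
  assume s: "0 < s" "s < 1"
  let ?a = "norm (y + t *\<^sub>R x)" and ?b = "norm (y + u *\<^sub>R x)"
  have "y + ((1 - s) *\<^sub>R t + s *\<^sub>R u) *\<^sub>R x = (1 - s) *\<^sub>R (y + t *\<^sub>R x) + s *\<^sub>R (y + u *\<^sub>R x)"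
    by (simp add: algebra_simps)
  then have "norm (y + ((1 - s) *\<^sub>R t + s *\<^sub>R u) *\<^sub>R x) \<le> (1 - s) * ?a + s * ?b"
    using s norm_triangle_ineq[of "(1 - s) *\<^sub>R (y + t *\<^sub>R x)" "s *\<^sub>R (y + u *\<^sub>R x)"] by simp
  then have "(norm (y + ((1 - s) *\<^sub>R t + s *\<^sub>R u) *\<^sub>R x))\<^sup>2 \<le> ((1 - s) * ?a + s * ?b)\<^sup>2"
    by (intro power_mono) auto
  \<comment> \<open>The gap between the square of the mean and the mean of the squares is an
    explicit nonnegative term.\<close>
  also have "\<dots> = (1 - s) * ?a\<^sup>2 + s * ?b\<^sup>2 - s * (1 - s) * (?a - ?b)\<^sup>2"
    by (simp add: power2_eq_square algebra_simps)
  also have "\<dots> \<le> (1 - s) * ?a\<^sup>2 + s * ?b\<^sup>2"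
    using s by simp
  finally show "(norm (y + ((1 - s) *\<^sub>R t + s *\<^sub>R u) *\<^sub>R x))\<^sup>2 \<le> (1 - s) * ?a\<^sup>2 + s * ?b\<^sup>2" .
qed auto

lemma norm_affine_square_measurable:
  fixes x y :: "'a::real_normed_vector"
  shows "(\<lambda>t. (norm (y + t *\<^sub>R x))\<^sup>2) \<in> borel_measurable borel"
  by (intro borel_measurable_continuous_onI continuous_intros)

lemma norm_affine_square_integrable:
  fixes x y :: "'a::real_normed_vector"
  shows "integrable real_gauss (\<lambda>t. (norm (y + t *\<^sub>R x))\<^sup>2)"
proof (rule Bochner_Integration.integrable_bound)
  interpret prob_space real_gauss by (rule prob_space_real_gauss)
  show "integrable real_gauss (\<lambda>t. 2 * (norm y)\<^sup>2 + 2 * (norm x)\<^sup>2 * t\<^sup>2)"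
    using real_gauss_moments(3) by simp
  show "(\<lambda>t. (norm (y + t *\<^sub>R x))\<^sup>2) \<in> borel_measurable real_gauss"
    using norm_affine_square_measurable[of y x] by simp
  have "(norm (y + t *\<^sub>R x))\<^sup>2 \<le> 2 * (norm y)\<^sup>2 + 2 * (norm x)\<^sup>2 * t\<^sup>2" for t
  proof -
    have "(norm (y + t *\<^sub>R x))\<^sup>2 \<le> (norm y + \<bar>t\<bar> * norm x)\<^sup>2"
      using norm_triangle_ineq[of y "t *\<^sub>R x"] by (intro power_mono) auto
    also have "\<dots> \<le> 2 * (norm y)\<^sup>2 + 2 * (\<bar>t\<bar> * norm x)\<^sup>2"
      using sum_squares_bound[of "norm y" "\<bar>t\<bar> * norm x"] by (simp add: power2_sum)
    finally show ?thesis by (simp add: power_mult_distrib mult_ac)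
  qed
  then show "AE t in real_gauss. norm ((norm (y + t *\<^sub>R x))\<^sup>2)
      \<le> norm (2 * (norm y)\<^sup>2 + 2 * (norm x)\<^sup>2 * t\<^sup>2)"
    by auto
qed

text \<open>Adding a centered term can only increase the mean square. This is how the imaginary part
  of a complex Gaussian is brought in.\<close>

lemma jensen_centered:
  fixes x y :: "'a::real_normed_vector"
  shows "(norm y)\<^sup>2 \<le> (\<integral>t. (norm (y + t *\<^sub>R x))\<^sup>2 \<partial>real_gauss)"
proof -
  interpret prob_space real_gauss by (rule prob_space_real_gauss)
  show ?thesis
    using jensens_inequality[OF real_gauss_moments(1) _ _
        norm_affine_square_integrable[of y x] convex_on_norm_affine_square]
    by (simp add: real_gauss_moments(2))
qed

text \<open>Since the Gaussian is symmetric, Jensen's inequality can be applied to \<open>\<bar>t\<bar>\<close>, whose mean is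
  \<open>1 / sqrt pi\<close>, and the even convex function obtained by averaging over \<open>t\<close> and \<open>- t\<close>.\<close>
lemma jensen_two_sided:
  fixes x y :: "'a::real_normed_vector"
  shows "((norm (y + (1 / sqrt pi) *\<^sub>R x))\<^sup>2 + (norm (y - (1 / sqrt pi) *\<^sub>R x))\<^sup>2) / 2
    \<le> (\<integral>t. (norm (y + t *\<^sub>R x))\<^sup>2 \<partial>real_gauss)"
proof -
  interpret prob_space real_gauss by (rule prob_space_real_gauss)
  let ?\<phi> = "\<lambda>t. (norm (y + t *\<^sub>R x))\<^sup>2"
  let ?\<psi> = "\<lambda>t. (norm (y + t *\<^sub>R x))\<^sup>2 + (norm (y + t *\<^sub>R (- x)))\<^sup>2"
  have even: "?\<psi> \<bar>t\<bar> = ?\<psi> t" for t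
    by (cases "t \<ge> 0") auto
  have int: "integrable real_gauss ?\<phi>"
      "integrable real_gauss (\<lambda>t. (norm (y + t *\<^sub>R (- x)))\<^sup>2)"
    by (rule norm_affine_square_integrable)+
  have "?\<psi> (\<integral>t. \<bar>t\<bar> \<partial>real_gauss) \<le> (\<integral>t. ?\<psi> \<bar>t\<bar> \<partial>real_gauss)"
  proof (rule jensens_inequality)
    show "integrable real_gauss (\<lambda>t. ?\<psi> \<bar>t\<bar>)"
      unfolding even using int by (rule Bochner_Integration.integrable_add)
    show "convex_on UNIV ?\<psi>"
      by (intro convex_on_add convex_on_norm_affine_square)
  qed (auto intro: real_gauss_moments)
  also have "\<dots> = (\<integral>t. ?\<phi> t \<partial>real_gauss) + (\<integral>t. ?\<phi> (- t) \<partial>real_gauss)"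
    unfolding even using int by simp
  also have "(\<integral>t. ?\<phi> (- t) \<partial>real_gauss) = (\<integral>t. ?\<phi> t \<partial>real_gauss)"
    by (rule real_gauss_reflect) (rule norm_affine_square_measurable)
  finally show ?thesis
    by (simp add: real_gauss_moments(5))
qed

lemma Complex_measurable [measurable]:
  "(\<lambda>(a, b). Complex a b) \<in> borel_measurable (real_gauss \<Otimes>\<^sub>M real_gauss)"
proof -
  have "(\<lambda>p. complex_of_real (fst p) + \<i> * complex_of_real (snd p))
      \<in> borel_measurable (real_gauss \<Otimes>\<^sub>M real_gauss)"
    by measurable
  then show ?thesis
    by (simp add: Complex_eq case_prod_beta)
qed

section \<open>Comparison of random signs with complex Gaussians\<close>

lemma sets_cgauss [measurable_cong]: "sets cgauss = sets borel"
  by (simp add: cgauss_def)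

lemma prob_space_cgauss: "prob_space cgauss"
proof -
  interpret prob_space real_gauss by (rule prob_space_real_gauss)
  interpret P: pair_prob_space real_gauss real_gauss ..
  show ?thesis
    unfolding cgauss_def by (intro P.prob_space_distr Complex_measurable)
qed

lemma cgauss_square_integrable: "integrable cgauss (\<lambda>g. (norm g)\<^sup>2)"
proof -
  interpret prob_space real_gauss by (rule prob_space_real_gauss)
  interpret P: pair_prob_space real_gauss real_gauss ..
  have "integrable (real_gauss \<Otimes>\<^sub>M real_gauss) (\<lambda>p. (fst p)\<^sup>2)"
    by (rule integrable_distr[of fst _ real_gauss "\<lambda>t. t\<^sup>2"])
      (simp_all add: distr_pair_fst real_gauss_moments)
  moreover have "integrable (real_gauss \<Otimes>\<^sub>M real_gauss) (\<lambda>p. (snd p)\<^sup>2)"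
    using P.integrable_product_swap[OF calculation] by (simp add: case_prod_unfold)
  ultimately have "integrable (real_gauss \<Otimes>\<^sub>M real_gauss) (\<lambda>p. (fst p)\<^sup>2 + (snd p)\<^sup>2)"
    by (rule Bochner_Integration.integrable_add)
  then show ?thesis
    unfolding cgauss_def
    by (subst integrable_distr_eq[OF Complex_measurable]) (auto simp: case_prod_beta cmod_power2)
qed

lemma nn_integral_rademacher:
  "(\<integral>\<^sup>+e. f e \<partial>rademacher) = (f (- 1) + f 1) / 2"
  unfolding rademacher_def by (subst nn_integral_pmf_of_set) (auto simp: numeral_eq_Suc)

lemma prob_space_rademacher: "prob_space rademacher"
  unfolding rademacher_def by (rule measure_pmf.prob_space_axioms)

lemma rademacher_component_measurable:
  assumes "i \<in> I"
  shows "(\<lambda>\<epsilon>. complex_of_real (\<epsilon> i / r)) \<in> borel_measurable (PiM I (\<lambda>_. rademacher))"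
proof -
  have "(\<lambda>e. complex_of_real (e / r)) \<in> borel_measurable rademacher"
    by (simp add: rademacher_def)
  from measurable_compose[OF measurable_component_singleton[OF assms] this]
  show ?thesis .
qed

text \<open>The scaled sign is compared with the real part by \<open>jensen_two_sided\<close>, then
  the imaginary part is added by \<open>jensen_centered\<close>. The offset \<open>y\<close> stands
  for all other coordinates.\<close>

lemma rademacher_le_cgauss_1:
  assumes cb: "complex_banach cmul"
  shows "(\<integral>\<^sup>+e. ennreal ((norm (y + cmul (complex_of_real (e / sqrt pi)) x))\<^sup>2) \<partial>rademacher)
    \<le> (\<integral>\<^sup>+g. ennreal ((norm (y + cmul g x))\<^sup>2) \<partial>cgauss)"
proof -
  interpret prob_space real_gauss by (rule prob_space_real_gauss)
  interpret P: pair_prob_space real_gauss real_gauss ..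
  have real: "cmul (complex_of_real r) z = r *\<^sub>R z" for r z
    using cb by (simp add: complex_banach_def)
  have meas: "(\<lambda>g. ennreal ((norm (y + cmul g x))\<^sup>2)) \<in> borel_measurable borel"
    using norm_random_sum_measurable[OF cb, of "{()}" "\<lambda>_ g. g" borel y "\<lambda>_. x"] by simp
  have nn: "(\<integral>\<^sup>+t. ennreal ((norm (z + t *\<^sub>R v))\<^sup>2) \<partial>real_gauss)
      = ennreal (\<integral>t. (norm (z + t *\<^sub>R v))\<^sup>2 \<partial>real_gauss)" for z v :: 'a
    by (intro nn_integral_eq_integral norm_affine_square_integrable) auto
  have "(\<integral>\<^sup>+e. ennreal ((norm (y + cmul (complex_of_real (e / sqrt pi)) x))\<^sup>2) \<partial>rademacher)
      = ennreal (((norm (y + (1 / sqrt pi) *\<^sub>R x))\<^sup>2 + (norm (y - (1 / sqrt pi) *\<^sub>R x))\<^sup>2) / 2)"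
    unfolding nn_integral_rademacher real
    by (simp add: ennreal_plus [symmetric] divide_ennreal [symmetric] add.commute del: ennreal_plus)
  also have "\<dots> \<le> ennreal (\<integral>t. (norm (y + t *\<^sub>R x))\<^sup>2 \<partial>real_gauss)"
    by (intro ennreal_leI jensen_two_sided)
  also have "\<dots> = (\<integral>\<^sup>+a. ennreal ((norm (y + a *\<^sub>R x))\<^sup>2) \<partial>real_gauss)"
    by (rule nn [symmetric])
  also have "\<dots> \<le> (\<integral>\<^sup>+a. \<integral>\<^sup>+b. ennreal ((norm (y + a *\<^sub>R x + b *\<^sub>R cmul \<i> x))\<^sup>2)
      \<partial>real_gauss \<partial>real_gauss)"
    by (intro nn_integral_mono, subst nn, intro ennreal_leI jensen_centered)
  also have "\<dots> = (\<integral>\<^sup>+a. \<integral>\<^sup>+b. ennreal ((norm (y + cmul (Complex a b) x))\<^sup>2)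
      \<partial>real_gauss \<partial>real_gauss)"
    by (subst (2) complex_banach_decomp[OF cb]) (simp add: add.assoc)
  also have "\<dots> = (\<integral>\<^sup>+p. ennreal ((norm (y + cmul (case p of (a, b) \<Rightarrow> Complex a b) x))\<^sup>2)
      \<partial>(real_gauss \<Otimes>\<^sub>M real_gauss))"
    by (subst nn_integral_fst [symmetric])
      (use measurable_compose[OF Complex_measurable meas] in auto)
  also have "\<dots> = (\<integral>\<^sup>+g. ennreal ((norm (y + cmul g x))\<^sup>2) \<partial>cgauss)"
    unfolding cgauss_def by (rule nn_integral_distr [symmetric, OF Complex_measurable]) (use meas in simp)
  finally show ?thesis .
qed

text \<open>Signs are replaced one at a time; the arbitrary offset \<open>y\<close> absorbs the last
  sign while the induction hypothesis treats the others. The map \<open>h\<close> matches the index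
  set of the signs with the initial segments occurring in \<open>GAP\<close>.\<close>

lemma rademacher_le_cgauss_nn:
  fixes N :: nat
  assumes cb: "complex_banach cmul" and "inj_on h {..<N}"
  shows "(\<integral>\<^sup>+\<epsilon>. ennreal ((norm (y + (\<Sum>k<N. cmul (complex_of_real (\<epsilon> (h k) / sqrt pi)) (x k))))\<^sup>2)
      \<partial>PiM (h ` {..<N}) (\<lambda>_. rademacher))
    \<le> (\<integral>\<^sup>+g. ennreal ((norm (y + (\<Sum>k<N. cmul (g k) (x k))))\<^sup>2) \<partial>PiM {..<N} (\<lambda>_. cgauss))"
  using assms(2)
proof (induction N arbitrary: y)
  case 0
  show ?case by (simp add: nn_integral_empty space_PiM)
next
  case (Suc N)
  interpret R: product_sigma_finite "\<lambda>_. rademacher"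
    by (intro product_sigma_finite.intro prob_space_imp_sigma_finite prob_space_rademacher)
  interpret G: product_sigma_finite "\<lambda>_. cgauss"
    by (intro product_sigma_finite.intro prob_space_imp_sigma_finite prob_space_cgauss)
  let ?S = "\<lambda>g y. norm (y + (\<Sum>k<N. cmul (g k) (x k)))"
  let ?c = "\<lambda>e. cmul (complex_of_real (e / sqrt pi)) (x N)"
  have hN: "h N \<notin> h ` {..<N}"
    using Suc.prems by (auto dest: inj_onD)
  have ne: "h k \<noteq> h N" if "k < N" for k
    using hN that by (metis imageI lessThan_iff)
  have meas_S: "(\<lambda>g. ennreal ((?S g z)\<^sup>2)) \<in> borel_measurable (PiM {..<N} (\<lambda>_. cgauss))" for z
    using norm_random_sum_measurable[OF cb, of "{..<N}" "\<lambda>k g. g k" "PiM {..<N} (\<lambda>_. cgauss)" z x]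
    by simp
  have meas_add: "(\<lambda>g. ennreal ((?S g z)\<^sup>2) + ennreal ((?S g z')\<^sup>2))
      \<in> borel_measurable (PiM {..<N} (\<lambda>_. cgauss))" for z z'
    using meas_S[of z] meas_S[of z'] by measurable
  have "(\<integral>\<^sup>+\<epsilon>. ennreal ((norm (y + (\<Sum>k<Suc N. cmul (complex_of_real (\<epsilon> (h k) / sqrt pi)) (x k))))\<^sup>2)
      \<partial>PiM (h ` {..<Suc N}) (\<lambda>_. rademacher))
    = (\<integral>\<^sup>+e. \<integral>\<^sup>+\<epsilon>. ennreal ((?S (\<lambda>k. complex_of_real (\<epsilon> (h k) / sqrt pi)) (y + ?c e))\<^sup>2)
        \<partial>PiM (h ` {..<N}) (\<lambda>_. rademacher) \<partial>rademacher)"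
  proof -
    have "(\<lambda>\<epsilon>. norm (y + (\<Sum>k<Suc N. cmul (complex_of_real (\<epsilon> (h k) / sqrt pi)) (x k))))
        \<in> borel_measurable (PiM (insert (h N) (h ` {..<N})) (\<lambda>_. rademacher))"
      by (intro norm_random_sum_measurable[OF cb] rademacher_component_measurable)
        (auto simp: less_Suc_eq)
    then show ?thesis
      unfolding lessThan_Suc image_insert
      by (subst R.product_nn_integral_insert_rev)
        (use hN ne in \<open>auto simp: add.assoc intro!: nn_integral_cong\<close>)
  qed
  also have "\<dots> \<le> (\<integral>\<^sup>+e. \<integral>\<^sup>+g. ennreal ((?S g (y + ?c e))\<^sup>2) \<partial>PiM {..<N} (\<lambda>_. cgauss) \<partial>rademacher)"
    using Suc.prems by (intro nn_integral_mono Suc.IH) (auto simp: inj_on_def)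
  \<comment> \<open>A Rademacher average has two terms, so this interchange is just additivity of
    the Gaussian integral.\<close>
  also have "\<dots> = (\<integral>\<^sup>+g. \<integral>\<^sup>+e. ennreal ((?S g (y + ?c e))\<^sup>2) \<partial>rademacher \<partial>PiM {..<N} (\<lambda>_. cgauss))"
    unfolding nn_integral_rademacher nn_integral_divide[OF meas_add]
      nn_integral_add[OF meas_S meas_S] ..
  also have "\<dots> \<le> (\<integral>\<^sup>+g. \<integral>\<^sup>+\<gamma>. ennreal ((?S g (y + cmul \<gamma> (x N)))\<^sup>2) \<partial>cgauss \<partial>PiM {..<N} (\<lambda>_. cgauss))"
  proof (intro nn_integral_mono)
    fix g
    show "(\<integral>\<^sup>+e. ennreal ((?S g (y + ?c e))\<^sup>2) \<partial>rademacher)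
        \<le> (\<integral>\<^sup>+\<gamma>. ennreal ((?S g (y + cmul \<gamma> (x N)))\<^sup>2) \<partial>cgauss)"
      using rademacher_le_cgauss_1[OF cb, of "y + (\<Sum>k<N. cmul (g k) (x k))" "x N"]
      by (simp only: add_ac)
  qed
  also have "\<dots> = (\<integral>\<^sup>+g. ennreal ((norm (y + (\<Sum>k<Suc N. cmul (g k) (x k))))\<^sup>2) \<partial>PiM {..<Suc N} (\<lambda>_. cgauss))"
  proof -
    have "(\<lambda>g. norm (y + (\<Sum>k\<in>{..<Suc N}. cmul (g k) (x k))))
        \<in> borel_measurable (PiM (insert N {..<N}) (\<lambda>_. cgauss))"
      unfolding lessThan_Suc by (rule norm_random_sum_measurable[OF cb]) auto
    then show ?thesis
      unfolding lessThan_Suc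
      by (subst G.product_nn_integral_insert) (auto simp: add.assoc add.commute intro!: nn_integral_cong)
  qed
  finally show ?case .
qed

section \<open>Summing norms and point evaluations\<close>

text \<open>Finiteness of the Gaussian second moment permits the return from nonnegative extended
  integrals to Bochner integrals, which are \<open>0\<close> by convention for nonintegrable
  functions. The majorant is Cauchy--Schwarz over \<open>N\<close> terms.\<close>

lemma cgauss_sum_square_integrable:
  fixes N :: nat
  assumes cb: "complex_banach cmul"
  shows "integrable (PiM {..<N} (\<lambda>_. cgauss)) (\<lambda>g. (norm (\<Sum>k<N. cmul (g k) (x k)))\<^sup>2)"
proof (rule Bochner_Integration.integrable_bound)
  let ?M = "PiM {..<N} (\<lambda>_. cgauss)"
  have "integrable ?M (\<lambda>g. (norm (g k))\<^sup>2)" if "k < N" for k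
  proof (rule integrable_distr[where T = "\<lambda>g. g k" and M' = cgauss and f = "\<lambda>g. (norm g)\<^sup>2"])
    show "(\<lambda>g. g k) \<in> measurable ?M cgauss"
      using that by simp
    show "integrable (distr ?M cgauss (\<lambda>g. g k)) (\<lambda>g. (norm g)\<^sup>2)"
      using that cgauss_square_integrable prob_space_cgauss
      by (subst distr_PiM_component) auto
  qed
  then show "integrable ?M (\<lambda>g. real N * (\<Sum>k<N. (norm (g k))\<^sup>2 * (norm (x k))\<^sup>2))"
    by auto
  have "(\<lambda>g. norm (0 + (\<Sum>k<N. cmul (g k) (x k)))) \<in> borel_measurable ?M"
    by (intro norm_random_sum_measurable[OF cb]) auto
  then show "(\<lambda>g. (norm (\<Sum>k<N. cmul (g k) (x k)))\<^sup>2) \<in> borel_measurable ?M"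
    by simp
  have "(norm (\<Sum>k<N. cmul (g k) (x k)))\<^sup>2
      \<le> real N * (\<Sum>k<N. (norm (g k))\<^sup>2 * (norm (x k))\<^sup>2)" for g
  proof -
    have "norm (\<Sum>k<N. cmul (g k) (x k)) \<le> (\<Sum>k<N. norm (g k) * norm (x k))"
      using cb by (intro sum_norm_le) (simp add: complex_banach_def)
    then have "(norm (\<Sum>k<N. cmul (g k) (x k)))\<^sup>2 \<le> (\<Sum>k<N. norm (g k) * norm (x k))\<^sup>2"
      by (intro power_mono) auto
    also have "\<dots> \<le> (\<Sum>k<N. (norm (g k) * norm (x k))\<^sup>2) * real N"
      using sum_squared_le_sum_of_squares[of "\<lambda>k. norm (g k) * norm (x k)" "{..<N}"]
      by (simp add: mult.commute)
    finally show ?thesis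
      by (simp add: power_mult_distrib mult.commute)
  qed
  then show "AE g in ?M. norm ((norm (\<Sum>k<N. cmul (g k) (x k)))\<^sup>2)
      \<le> norm (real N * (\<Sum>k<N. (norm (g k))\<^sup>2 * (norm (x k))\<^sup>2))"
    by (auto intro!: always_eventually order_trans[OF _ abs_ge_self])
qed

lemma rademacher_le_cgauss:
  fixes N :: nat
  assumes cb: "complex_banach cmul" and h: "bij_betw h {..<N} I"
  shows "sqrt (\<integral>\<epsilon>. (norm (\<Sum>i\<in>I. \<epsilon> i *\<^sub>R x i))\<^sup>2 \<partial>PiM I (\<lambda>_. rademacher))
    \<le> sqrt pi * sqrt (\<integral>g. (norm (\<Sum>k<N. cmul (g k) (x (h k))))\<^sup>2 \<partial>PiM {..<N} (\<lambda>_. cgauss))"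
proof -
  let ?R = "PiM I (\<lambda>_. rademacher)" and ?G = "PiM {..<N} (\<lambda>_. cgauss)"
  let ?r = "\<lambda>\<epsilon>. (norm (\<Sum>i\<in>I. \<epsilon> i *\<^sub>R x i))\<^sup>2" and ?g = "\<lambda>g. (norm (\<Sum>k<N. cmul (g k) (x (h k))))\<^sup>2"
  let ?s = "\<lambda>\<epsilon>. (norm (0 + (\<Sum>k<N. cmul (complex_of_real (\<epsilon> (h k) / sqrt pi)) (x (h k)))))\<^sup>2"
  have I: "I = h ` {..<N}" "inj_on h {..<N}"
    using h by (auto simp: bij_betw_def)
  have real: "cmul (complex_of_real r) z = r *\<^sub>R z" for r z
    using cb by (simp add: complex_banach_def)
  have s: "?s \<epsilon> = ?r \<epsilon> / pi" for \<epsilon>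
  proof -
    have "(\<Sum>k<N. cmul (complex_of_real (\<epsilon> (h k) / sqrt pi)) (x (h k)))
        = (1 / sqrt pi) *\<^sub>R (\<Sum>i\<in>I. \<epsilon> i *\<^sub>R x i)"
      unfolding real scaleR_sum_right sum.reindex_bij_betw[OF h, symmetric] by simp
    then show ?thesis
      by (simp add: power_divide)
  qed
  have "(\<lambda>\<epsilon>. norm (0 + (\<Sum>k<N. cmul (complex_of_real (\<epsilon> (h k) / sqrt pi)) (x (h k)))))
      \<in> borel_measurable ?R"
    by (intro norm_random_sum_measurable[OF cb] rademacher_component_measurable) (auto simp: I)
  then have meas: "?s \<in> borel_measurable ?R"
    by (rule borel_measurable_power)
  have "(\<integral>\<epsilon>. ?s \<epsilon> \<partial>?R) = enn2real (\<integral>\<^sup>+\<epsilon>. ennreal (?s \<epsilon>) \<partial>?R)"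
    using meas by (intro integral_eq_nn_integral) auto
  also have "\<dots> \<le> enn2real (\<integral>\<^sup>+g. ennreal (?g g) \<partial>?G)"
  \<comment> \<open>Since \<open>enn2real\<close> sends infinity to \<open>0\<close>, monotonicity
    requires the larger integral to be finite.\<close>
  proof (rule enn2real_mono)
    show "(\<integral>\<^sup>+\<epsilon>. ennreal (?s \<epsilon>) \<partial>?R) \<le> (\<integral>\<^sup>+g. ennreal (?g g) \<partial>?G)"
      using rademacher_le_cgauss_nn[OF cb I(2), of 0 "\<lambda>k. x (h k)"] by (simp add: I(1))
    show "(\<integral>\<^sup>+g. ennreal (?g g) \<partial>?G) < top"
      using cgauss_sum_square_integrable[OF cb, of N "\<lambda>k. x (h k)"]
      by (subst nn_integral_eq_integral) auto
  qed
  also have "\<dots> = (\<integral>g. ?g g \<partial>?G)"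
    using cgauss_sum_square_integrable[OF cb, of N "\<lambda>k. x (h k)"]
    by (intro integral_eq_nn_integral [symmetric]) auto
  finally have "(\<integral>\<epsilon>. ?r \<epsilon> \<partial>?R) \<le> pi * (\<integral>g. ?g g \<partial>?G)"
    unfolding s by (simp add: field_simps)
  then show ?thesis
    unfolding real_sqrt_mult [symmetric] by (rule real_sqrt_le_mono)
qed

section \<open>Point evaluations in the unit ball of the bidual\<close>

lemma cmod_le_dnorm:
  assumes "f \<in> cdual cmul" "norm u \<le> 1"
  shows "cmod (f u) \<le> dnorm f"
proof -
  obtain K where K: "\<And>x. cmod (f x) \<le> K * norm x"
    using assms(1) by (auto simp: cdual_def)
  have "cmod (f x) \<le> \<bar>K\<bar>" if "norm x \<le> 1" for x
  proof -
    have "K * norm x \<le> \<bar>K\<bar> * 1"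
      using that by (intro mult_mono) auto
    with K[of x] show ?thesis by simp
  qed
  then have "bdd_above ((\<lambda>x. cmod (f x)) ` {x. norm x \<le> 1})"
    by (intro bdd_aboveI2[of _ _ "\<bar>K\<bar>"]) auto
  then show ?thesis
    unfolding dnorm_def using assms(2) by (intro cSUP_upper) auto
qed

lemma eval_in_bidual_ball: "norm u \<le> 1 \<Longrightarrow> (\<lambda>f. f u) \<in> bidual_ball cmul"
  by (auto simp: bidual_ball_def intro: cmod_le_dnorm)

text \<open>Evaluation at the normalized vector \<open>v\<close> belongs to the bidual ball and
  competes in the supremum; homogeneity restores the factor \<open>norm v\<close>.\<close>

lemma sum_cdual_le:
  assumes cb: "complex_banach cmul" and ys: "\<And>j. j < k \<Longrightarrow> ys j \<in> cdual cmul"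
  shows "(\<Sum>j<k. cmod (ys j v)) \<le> norm v * (SUP \<phi>\<in>bidual_ball cmul. \<Sum>j<k. cmod (\<phi> (ys j)))"
proof -
  have smult: "ys j (r *\<^sub>R z) = complex_of_real r * ys j z" if "j < k" for j r z
  proof -
    have "ys j (cmul (complex_of_real r) z) = complex_of_real r * ys j z"
      using ys[OF that] by (simp add: cdual_def)
    then show ?thesis
      using cb by (simp add: complex_banach_def)
  qed
  \<comment> \<open>For \<open>v = 0\<close> division by zero gives \<open>u = 0\<close>, so no case
    distinction arises.\<close>
  define u where "u = (1 / norm v) *\<^sub>R v"
  have v: "v = norm v *\<^sub>R u"
    by (simp add: u_def)
  have u: "norm u \<le> 1"
    by (simp add: u_def)
  \<comment> \<open>A real supremum bounds its members only when the set is bounded; the dual norms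
    supply the bound.\<close>
  have bdd: "bdd_above ((\<lambda>\<phi>. \<Sum>j<k. cmod (\<phi> (ys j))) ` bidual_ball cmul)"
    using ys by (intro bdd_aboveI2[of _ _ "\<Sum>j<k. dnorm (ys j)"] sum_mono) (auto simp: bidual_ball_def)
  have "(\<Sum>j<k. cmod (ys j v)) = norm v * (\<Sum>j<k. cmod (ys j u))"
    by (subst v) (simp add: smult norm_mult sum_distrib_left)
  also have "\<dots> \<le> norm v * (SUP \<phi>\<in>bidual_ball cmul. \<Sum>j<k. cmod (\<phi> (ys j)))"
    using cSUP_upper[OF eval_in_bidual_ball[OF u] bdd] by (intro mult_left_mono) auto
  finally show ?thesis .
qed

text \<open>The mean of the norm is an admissible constant in the infimum defining
  \<open>pi1_adj\<close>: \<open>weissler_n\<close> handles each functional, the finite sum moves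
  under the integral, and \<open>sum_cdual_le\<close> bounds the integrand.\<close>

lemma pi1_adj_le:
  assumes cb: "complex_banach cmul" and h: "bij_betw h {..<N} A"
    and A: "\<forall>\<alpha>\<in>A. \<forall>\<beta>\<in>A. (\<forall>i<n. \<alpha> i = \<beta> i) \<longrightarrow> \<alpha> = \<beta>"
  shows "pi1_adj cmul (\<lambda>i. x (h i)) N \<le>
    (\<integral>w. norm (\<Sum>\<alpha>\<in>A. cmul (complex_of_real (sqrt 2 ^ mabs n \<alpha>) * mpow n w \<alpha>) (x \<alpha>)) \<partial>torus n)"
proof -
  have fin: "finite A"
    using h bij_betw_finite by blast
  define F where "F w = (\<Sum>\<alpha>\<in>A. cmul (complex_of_real (sqrt 2 ^ mabs n \<alpha>) * mpow n w \<alpha>) (x \<alpha>))" for w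
  have int_F: "integrable (torus n) (\<lambda>w. norm (F w))"
  proof (rule torus_integrable_bounded)
    have "(\<lambda>w. norm (0 + F w)) \<in> borel_measurable (torus n)"
      unfolding F_def by (intro norm_random_sum_measurable[OF cb] fin) measurable
    then show "(\<lambda>w. norm (F w)) \<in> borel_measurable (torus n)" by simp
    show "norm (norm (F w)) \<le> (\<Sum>\<alpha>\<in>A. sqrt 2 ^ mabs n \<alpha> * norm (x \<alpha>))"
      if "\<forall>i<n. norm (w i) = 1" for w
      unfolding F_def real_norm_def abs_norm_cancel
      using cb norm_mpow[OF that]
      by (intro sum_norm_le) (simp add: complex_banach_def norm_mult norm_power)
  qed
  have F_dual: "f (F w) = torus_poly A (\<lambda>\<alpha>. f (x \<alpha>)) n w" if f: "f \<in> cdual cmul" for f w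
  proof -
    have add: "f (a + b) = f a + f b" for a b
      using f by (simp add: cdual_def)
    have zero: "f 0 = 0"
      using add[of 0 0] by simp
    have "f (sum g B) = (\<Sum>b\<in>B. f (g b))" if "finite B" for g and B :: "(nat \<Rightarrow> nat) set"
      using that by (induction B rule: finite_induct) (auto simp: add zero)
    then show ?thesis
      using f fin by (simp add: F_def torus_poly_def cdual_def)
  qed
  have "(\<Sum>j<k. sqrt (\<Sum>i<N. (cmod (ys j (x (h i))))\<^sup>2))
      \<le> (\<integral>w. norm (F w) \<partial>torus n) * (SUP \<phi>\<in>bidual_ball cmul. \<Sum>j<k. cmod (\<phi> (ys j)))"
    if ys: "\<forall>j<k. ys j \<in> cdual cmul" for k :: nat and ys
  proof -
    let ?S = "SUP \<phi>\<in>bidual_ball cmul. \<Sum>j<k. cmod (\<phi> (ys j))"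
    have int: "integrable (torus n) (\<lambda>w. cmod (ys j (F w)))" if "j < k" for j
      using ys that torus_poly_integrable by (simp add: F_dual)
    have "(\<Sum>j<k. sqrt (\<Sum>i<N. (cmod (ys j (x (h i))))\<^sup>2))
        = (\<Sum>j<k. sqrt (\<Sum>\<alpha>\<in>A. (cmod (ys j (x \<alpha>)))\<^sup>2))"
      by (subst sum.reindex_bij_betw[OF h]) simp
    also have "\<dots> \<le> (\<Sum>j<k. \<integral>w. cmod (ys j (F w)) \<partial>torus n)"
      using ys weissler_n[OF fin A] by (intro sum_mono) (simp add: F_dual)
    also have "\<dots> = (\<integral>w. (\<Sum>j<k. cmod (ys j (F w))) \<partial>torus n)"
      using int by simp
    also have "\<dots> \<le> (\<integral>w. norm (F w) * ?S \<partial>torus n)"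
      using int int_F ys by (intro integral_mono sum_cdual_le[OF cb]) auto
    finally show ?thesis by simp
  qed
  then show ?thesis
    unfolding pi1_adj_def F_def [symmetric]
    by (intro cInf_lower bdd_belowI[of _ 0]) auto
qed

lemma finite_multi_idx: "finite (multi_idx n m)"
proof (rule finite_subset)
  show "multi_idx n m \<subseteq> {\<alpha>. \<forall>i. (i \<in> {..<n} \<longrightarrow> \<alpha> i \<in> {..m}) \<and> (i \<notin> {..<n} \<longrightarrow> \<alpha> i = 0)}"
    by (auto simp: multi_idx_def intro: order_trans[OF member_le_sum])
qed (intro finite_set_of_finite_funs finite_lessThan finite_atMost)

theorem theorem3p5:
  fixes cmul :: "complex \<Rightarrow> 'a::banach \<Rightarrow> 'a"
  assumes "complex_banach cmul"
    and "GAP cmul"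
  shows "\<exists>C\<ge>1. \<forall>(m::nat) (n::nat) (x::(nat \<Rightarrow> nat) \<Rightarrow> 'a).
    sqrt (\<integral>\<epsilon>. (norm (\<Sum>\<alpha>\<in>multi_idx n m. \<epsilon> \<alpha> *\<^sub>R x \<alpha>))\<^sup>2
             \<partial>(PiM (multi_idx n m) (\<lambda>_. rademacher)))
    \<le> C * (\<integral>w. norm (\<Sum>\<alpha>\<in>multi_idx n m.
                 cmul (complex_of_real (sqrt 2 ^ mabs n \<alpha>) * mpow n w \<alpha>) (x \<alpha>))
             \<partial>(PiM {..<n} (\<lambda>_. steinhaus)))"
proof -
  obtain C where "C \<ge> 1" and C: "\<And>(n::nat) (x::nat \<Rightarrow> 'a).
     sqrt (\<integral>g. (norm (\<Sum>i<n. cmul (g i) (x i)))\<^sup>2 \<partial>(PiM {..<n} (\<lambda>_. cgauss))) \<le> C * pi1_adj cmul x n"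
    using assms(2) by (auto simp: GAP_def)
  show ?thesis
  \<comment> \<open>The factor \<open>sqrt pi\<close> comes from replacing signs by Gaussians, and
    \<open>C\<close> from \<open>GAP\<close>; the torus inequality contributes constant
    \<open>1\<close>.\<close>
  proof (intro exI[of _ "sqrt pi * C"] conjI allI)
    have "1 * 1 \<le> sqrt pi * C"
      using \<open>C \<ge> 1\<close> pi_ge_two by (intro mult_mono) auto
    then show "sqrt pi * C \<ge> 1" by simp
  next
    fix m n :: nat and x :: "(nat \<Rightarrow> nat) \<Rightarrow> 'a"
    let ?A = "multi_idx n m"
    let ?D = "\<integral>w. norm (\<Sum>\<alpha>\<in>?A. cmul (complex_of_real (sqrt 2 ^ mabs n \<alpha>) * mpow n w \<alpha>) (x \<alpha>)) \<partial>torus n"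
    obtain h where h: "bij_betw h {..<card ?A} ?A"
      using ex_bij_betw_nat_finite[OF finite_multi_idx] by (auto simp: atLeast0LessThan)
    \<comment> \<open>Multi-indices vanish from position \<open>n\<close> on, so their first
      \<open>n\<close> entries determine them.\<close>
    have A: "\<forall>\<alpha>\<in>?A. \<forall>\<beta>\<in>?A. (\<forall>i<n. \<alpha> i = \<beta> i) \<longrightarrow> \<alpha> = \<beta>"
    proof (intro ballI impI ext)
      fix \<alpha> \<beta> i
      assume "\<alpha> \<in> ?A" "\<beta> \<in> ?A" "\<forall>i<n. \<alpha> i = \<beta> i"
      then show "\<alpha> i = \<beta> i"
        by (cases "i < n") (auto simp: multi_idx_def)
    qed
    have "sqrt (\<integral>\<epsilon>. (norm (\<Sum>\<alpha>\<in>?A. \<epsilon> \<alpha> *\<^sub>R x \<alpha>))\<^sup>2 \<partial>PiM ?A (\<lambda>_. rademacher))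
        \<le> sqrt pi * sqrt (\<integral>g. (norm (\<Sum>k<card ?A. cmul (g k) (x (h k))))\<^sup>2
            \<partial>PiM {..<card ?A} (\<lambda>_. cgauss))"
      by (rule rademacher_le_cgauss[OF assms(1) h])
    also have "\<dots> \<le> sqrt pi * (C * pi1_adj cmul (\<lambda>k. x (h k)) (card ?A))"
      by (intro mult_left_mono C) auto
    also have "\<dots> \<le> sqrt pi * (C * ?D)"
      using \<open>C \<ge> 1\<close> by (intro mult_left_mono pi1_adj_le[OF assms(1) h A]) auto
    finally show "sqrt (\<integral>\<epsilon>. (norm (\<Sum>\<alpha>\<in>?A. \<epsilon> \<alpha> *\<^sub>R x \<alpha>))\<^sup>2 \<partial>PiM ?A (\<lambda>_. rademacher))
        \<le> sqrt pi * C * ?D"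
      by (simp only: mult.assoc)
  qed
qed

end
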